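(* Let $d\ge1$, let $\emptyset\neq H\subset\mathbb{R}^d$, let $A\subset\mathbb{R}^d$ be Lebesgue measurable, and let $R,\Delta$ be real numbers with $d(H,A)\ge R\ge\Delta\ge0$ and $R>0$. Then $T_\Delta A$ is Lebesgue measurable and $$Leb(T_\Delta A)\ge\left(\frac{R-\Delta}{R}\right)^{d-1}Leb(A).$$
   Context: $d(\cdot,\cdot)$ is Euclidean distance, $d(x,H)=\inf_{y\in H}|x-y|$, $d(H,A)=\inf_{x\in A}d(x,H)$, and $Leb$ is Lebesgue measure on $\mathbb{R}^d$. Let $\bar H$ be the closure of $H$. For each $x\in\mathbb{R}^d$ let $\pi(x)$ be a point of $\bar H$ with $|x-\pi(x)|=d(x,H)$ (if there are several such points, $\pi(x)$ is any one of them). For $\Delta\ge0$ the approach map $T_\Delta:\mathbb{R}^d\to\mathbb{R}^d$ is $$T_\Delta x:=\begin{cases} x+\Delta\frac{\pi(x)-x}{|\pi(x)-x|}, & \text{if } d(x,H)>\Delta,\\ \pi(x), & \text{if } d(x,H)\le\Delta.\end{cases}$$ *)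

theory Defs
  imports "HOL-Analysis.Analysis"
begin

text \<open>d(H,A) = inf over x in A of d(x,H), valued in the extended reals (so it is +infinity for empty A).\<close>
definition set_distance :: "'a::euclidean_space set \<Rightarrow> 'a set \<Rightarrow> ereal" where
  "set_distance H A = (INF x\<in>A. ereal (infdist x H))"

definition nearest_selection :: "'a::euclidean_space set \<Rightarrow> ('a \<Rightarrow> 'a) \<Rightarrow> bool" where
  "nearest_selection H \<pi> \<longleftrightarrow> (\<forall>x. \<pi> x \<in> closure H \<and> dist x (\<pi> x) = infdist x H)"

definition approach_map :: "'a::euclidean_space set \<Rightarrow> ('a \<Rightarrow> 'a) \<Rightarrow> real \<Rightarrow> 'a \<Rightarrow> 'a" where
  "approach_map H \<pi> \<Delta> x =
     (if infdist x H > \<Delta> then x + \<Delta> *\<^sub>R ((\<pi> x - x) /\<^sub>R norm (\<pi> x - x)) else \<pi> x)"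

end

theory Submission
  imports Defs
begin

text \<open>The map is analysed on the set where the nearest point is unique and farther than \<open>\<Delta>\<close>
  away. If \<open>H\<close> is a single point, polar coordinates give the bound, since
  \<open>t - \<Delta> \<ge> ((R - \<Delta>) / R) t\<close> for \<open>t \<ge> R\<close>. If \<open>H\<close> is finite, the map is injective, because a
  point moved a positive distance short of \<open>H\<close> remembers its nearest point, and the bounds on the
  Voronoi cells add up. For general \<open>H\<close> and a compact set, finite approximations of \<open>H\<close> yield
  compact sets decreasing to the image. Inner regularity then reduces measurable sets to compact
  ones, provided the map sends null sets to null sets. This is not obvious, as the map tears along
  the cut locus, but it holds because the distance function has a Lipschitz gradient at the points
  that lie inside a segment realising the distance.\<close>

subsection \<open>Moving towards a nearest point\<close>

text \<open>The selection is arbitrary and possibly non-measurable, so the image of a measurable set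
  cannot be reached through measurability of the map; it is exhibited as a countable union of
  compact images plus a null set. Compactness is available where the nearest point is unique, since
  the nearest-point relation has a closed graph. The exponent is d - 1 rather than d because along
  each ray to the centre the map is a shift; only the directions transverse to the ray are
  contracted. The borderline \<open>R = \<Delta>\<close> is not vacuous: points at distance exactly
  \<open>R\<close> collapse onto the closure of \<open>H\<close>, and their images have to be null
  for measurability; for d = 1 the factor is 0^0 = 1, so these points have to form a null set as
  well.\<close>

definition toward :: "real \<Rightarrow> 'a::euclidean_space \<Rightarrow> 'a \<Rightarrow> 'a" where
  "toward t p x = x + (t / dist x p) *\<^sub>R (p - x)"

definition nearest :: "'a::euclidean_space set \<Rightarrow> 'a \<Rightarrow> 'a \<Rightarrow> bool" where
  "nearest C x p \<longleftrightarrow> p \<in> C \<and> dist x p = infdist x C"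

text \<open>For closed nonempty \<open>C\<close>, such a \<open>y\<close> lies on a segment
  realising the distance from \<open>x\<close> to \<open>C\<close>, with length \<open>t\<close>
  left before the far end \<open>x\<close>. Phrasing this through \<open>infdist\<close> alone,
  without naming a nearest point, makes the set closed.\<close>

definition extendable :: "'a::euclidean_space set \<Rightarrow> real \<Rightarrow> 'a set" where
  "extendable C t = {y. \<exists>x. dist x y = t \<and> infdist x C = infdist y C + t}"

lemma toward_alt:
  assumes "x \<noteq> p"
  shows "toward t p x = p + ((dist x p - t) / dist x p) *\<^sub>R (x - p)"
proof -
  have *: "(dist x p - t) / dist x p = 1 - t / dist x p"
    using assms by (simp add: field_simps)
  show ?thesis
    unfolding toward_def * by (simp add: algebra_simps)
qed

lemma dist_toward_target: "x \<noteq> p \<Longrightarrow> dist (toward t p x) p = \<bar>dist x p - t\<bar>"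
  by (simp add: toward_alt dist_norm)

lemma dist_toward_source: "x \<noteq> p \<Longrightarrow> dist x (toward t p x) = \<bar>t\<bar>"
  by (simp add: toward_def dist_norm norm_minus_commute)

lemma toward_toward:
  assumes "t < dist x p"
  shows "toward s p (toward t p x) = toward (t + s) p x"
proof (cases "x = p")
  case False
  have d: "dist (toward t p x) p = dist x p - t"
    using assms False by (simp add: dist_toward_target)
  then have "toward t p x \<noteq> p" using assms by auto
  then have "toward s p (toward t p x) = p + ((dist x p - t - s) / (dist x p - t)) *\<^sub>R (toward t p x - p)"
    by (simp add: toward_alt d)
  also have "\<dots> = p + ((dist x p - t - s) / dist x p) *\<^sub>R (x - p)"
    using assms False by (simp add: toward_alt)
  finally show ?thesis using False by (simp add: toward_alt algebra_simps)
qed (auto simp: toward_def)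

lemma toward_zero [simp]: "toward 0 p x = x"
  by (simp add: toward_def)

text \<open>Equality in the triangle inequality forces \<open>x\<close>, \<open>y\<close>,
  \<open>h\<close> onto one ray, because Euclidean balls are strictly convex.\<close>

lemma extension_unique:
  assumes r: "dist y h = r" "r > 0" and x: "dist x y = t" "dist x h \<ge> t + r"
  shows "x = toward (- t) h y"
proof -
  have "norm ((x - y) + (y - h)) = norm (x - y) + norm (y - h)"
    using assms norm_triangle_ineq[of "x - y" "y - h"] by (simp add: dist_norm)
  then have "t *\<^sub>R (y - h) = r *\<^sub>R (x - y)"
    using assms by (subst (asm) norm_triangle_eq) (simp add: dist_norm)
  then have "(t / r) *\<^sub>R (y - h) = x - y"
    using r by (metis divide_inverse_commute less_irrefl scaleR_scaleR scaleR_one left_inverse)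
  then show ?thesis using r by (simp add: toward_def algebra_simps)
qed

lemma nearest_exists: "closed C \<Longrightarrow> C \<noteq> {} \<Longrightarrow> \<exists>p. nearest C x p"
  unfolding nearest_def by (metis infdist_attains_inf)

text \<open>The distance to \<open>C\<close> is 1-Lipschitz and so falls by at most
  \<open>t\<close>, while \<open>p\<close> itself witnesses a fall of at least
  \<open>t\<close>.\<close>

lemma nearest_toward:
  assumes "nearest C x p" "0 \<le> t" "t \<le> infdist x C"
  shows "nearest C (toward t p x) p" "infdist (toward t p x) C = infdist x C - t"
proof -
  have "nearest C (toward t p x) p \<and> infdist (toward t p x) C = infdist x C - t"
  proof (cases "x = p")
    case True
    with assms show ?thesis by (auto simp: nearest_def toward_def)
  next
    case False
    have "infdist x C \<le> infdist (toward t p x) C + t"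
      using infdist_triangle[of x C "toward t p x"] dist_toward_source[OF False] assms by simp
    moreover have "dist (toward t p x) p = infdist x C - t"
      using dist_toward_target[OF False] assms by (simp add: nearest_def)
    moreover have "infdist (toward t p x) C \<le> dist (toward t p x) p"
      using assms by (auto simp: nearest_def intro: infdist_le)
    ultimately show ?thesis using assms by (auto simp: nearest_def)
  qed
  then show "nearest C (toward t p x) p" "infdist (toward t p x) C = infdist x C - t" by auto
qed

lemma toward_in_extendable:
  assumes "nearest C x p" "0 \<le> t" "t \<le> infdist x C" "0 < infdist x C"
  shows "toward t p x \<in> extendable C t"
proof -
  have "x \<noteq> p" using assms by (auto simp: nearest_def)
  then show ?thesis
    unfolding extendable_def using nearest_toward[OF assms(1-3)] dist_toward_source[of x p t] assms(2)
    by (auto intro!: exI[of _ x])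
qed

text \<open>Since \<open>dist x p\<close> is at least \<open>infdist x C\<close>, the path from
  \<open>x\<close> through \<open>y\<close> to \<open>p\<close> has no slack. Any nearest point of
  \<open>y\<close> therefore determines the far end; injectivity and uniqueness arguments below all
  rest on this.\<close>

lemma extendable_nearest:
  assumes y: "nearest C y p" "0 < infdist y C" and x: "dist x y = t" "infdist x C = infdist y C + t"
  shows "x = toward (- t) p y"
proof (rule extension_unique)
  show "dist y p = infdist y C" using y by (simp add: nearest_def)
  show "t + infdist y C \<le> dist x p"
    using x y infdist_le[of p C x] by (auto simp: nearest_def)
qed (use x y in auto)

lemma extendable_nearest_unique:
  assumes "y \<in> extendable C t" "0 < t" "0 < infdist y C" "nearest C y p" "nearest C y q"
  shows "p = q"
proof -
  obtain x where x: "dist x y = t" "infdist x C = infdist y C + t"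
    using assms by (auto simp: extendable_def)
  have "toward (- t) p y = toward (- t) q y"
    using extendable_nearest[OF assms(4,3) x] extendable_nearest[OF assms(5,3) x] by simp
  then have "t *\<^sub>R (p - y) = t *\<^sub>R (q - y)"
    using assms by (simp add: toward_def nearest_def)
  then show ?thesis using assms by simp
qed

text \<open>Removes the ambiguity of the selection: even if \<open>x\<close> has several nearest
  points, whichever one is chosen at \<open>x\<close> must be chosen again at every interior point
  of the segment towards it.\<close>

lemma nearest_on_extendable_segment:
  assumes p: "nearest C x p" "0 < t" "t < infdist x C" and q: "nearest C (toward t p x) q"
  shows "q = p"
proof (rule extendable_nearest_unique[OF _ \<open>0 < t\<close> _ q])
  show "toward t p x \<in> extendable C t"
    using p by (intro toward_in_extendable) auto
  show "0 < infdist (toward t p x) C" "nearest C (toward t p x) p"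
    using p nearest_toward[of C x p t] by auto
qed

lemma extendable_antimono:
  assumes "0 \<le> s" "s \<le> t"
  shows "extendable C t \<subseteq> extendable C s"
proof
  fix y assume "y \<in> extendable C t"
  then obtain x where x: "dist x y = t" "infdist x C = infdist y C + t"
    by (auto simp: extendable_def)
  show "y \<in> extendable C s"
  proof (cases "t = 0")
    case True
    then show ?thesis using \<open>y \<in> extendable C t\<close> assms by simp
  next
    case False
    then have "x \<noteq> y" using x by auto
    \<comment> \<open>The point of the segment from \<open>x\<close> to \<open>y\<close> at distance
      \<open>s\<close> from \<open>y\<close>. The 1-Lipschitz bounds on the two pieces are both
      equalities because their sum is.\<close>
    let ?z = "toward (t - s) y x"
    have *: "dist ?z y = s" "dist x ?z = t - s"
      using \<open>x \<noteq> y\<close> x assms by (auto simp: dist_toward_target dist_toward_source)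
    have "infdist x C \<le> infdist ?z C + (t - s)"
      using infdist_triangle[of x C ?z] * by simp
    moreover have "infdist ?z C \<le> infdist y C + s"
      using infdist_triangle[of ?z C y] * by simp
    ultimately show ?thesis using * x by (auto simp: extendable_def intro!: exI[of _ ?z])
  qed
qed

text \<open>Writing \<open>x = y + w\<close> with \<open>w\<close> on a fixed sphere turns the
  existential quantifier into a projection along a compact factor, and such projections preserve
  closedness.\<close>

lemma closed_extendable: "closed (extendable C t)" for C :: "'a::euclidean_space set"
proof -
  have eq: "extendable C t = {y. \<exists>w. w \<in> sphere 0 t \<and> (w, y) \<in> {(w, y). infdist (y + w) C = infdist y C + t}}"
  proof (intro set_eqI iffI; clarsimp simp: extendable_def)
    fix x y assume "infdist x C = infdist y C + dist x y"
    then show "\<exists>w. norm w = dist x y \<and> infdist (y + w) C = infdist y C + dist x y"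
      by (intro exI[of _ "x - y"]) (simp add: dist_norm)
  next
    fix y w assume "infdist (y + w) C = infdist y C + norm w"
    then show "\<exists>x. dist x y = norm w \<and> infdist x C = infdist y C + norm w"
      by (intro exI[of _ "y + w"]) (simp add: dist_norm)
  qed
  have "closed {(w, y). infdist (y + w) C = infdist y C + t}"
    unfolding case_prod_beta by (intro closed_Collect_eq continuous_intros)
  then show ?thesis unfolding eq by (intro closed_compact_projection) auto
qed

section \<open>Quadratic bounds and the gradient of the distance function\<close>

lemma norm_add_le_quadratic:
  fixes w v :: "'a::real_inner"
  assumes "w \<noteq> 0"
  shows "norm (w + v) \<le> norm w + (w \<bullet> v) / norm w + (norm v)\<^sup>2 / (2 * norm w)"
proof -
  let ?a = "norm w" let ?b = "norm (w + v)"
  have a: "?a > 0" using assms by simp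
  have "?b\<^sup>2 = ?a\<^sup>2 + 2 * (w \<bullet> v) + (norm v)\<^sup>2"
    by (simp add: power2_norm_eq_inner inner_add inner_commute)
  \<comment> \<open>Bounding the norm by its square in this way gives the tangent estimate without
    differentiation.\<close>
  moreover have "2 * ?a * ?b \<le> ?a\<^sup>2 + ?b\<^sup>2"
    using sum_squares_bound[of ?a ?b] by simp
  ultimately have "2 * ?a * ?b \<le> 2 * ?a\<^sup>2 + 2 * (w \<bullet> v) + (norm v)\<^sup>2" by linarith
  then show ?thesis
    using a by (simp add: field_simps power2_eq_square)
qed

text \<open>The vector \<open>(y - p) /\<^sub>R infdist y C\<close> is the gradient at
  \<open>y\<close>. The upper bound compares \<open>infdist z C\<close> with the distance to
  \<open>p\<close>; the lower bound compares it with \<open>infdist x C - dist x z\<close> for the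
  far end \<open>x\<close>, which lies on the ray from \<open>p\<close> through \<open>y\<close>.
  The constant \<open>c\<close> bounds the radii of both spheres from below.\<close>

lemma infdist_quadratic_bound:
  assumes y: "nearest C y p" "y \<in> extendable C \<delta>" and c: "0 < c" "c \<le> \<delta>" "c \<le> infdist y C"
  shows "\<bar>infdist z C - infdist y C - ((y - p) /\<^sub>R infdist y C) \<bullet> (z - y)\<bar> \<le> (norm (z - y))\<^sup>2 / (2 * c)"
proof -
  let ?r = "infdist y C" and ?v = "z - y"
  let ?\<xi> = "(y - p) /\<^sub>R ?r"
  have d: "dist y p = ?r" "p \<in> C" using y by (auto simp: nearest_def)
  have q: "(norm ?v)\<^sup>2 / (2 * s) \<le> (norm ?v)\<^sup>2 / (2 * c)" if "s \<ge> c" for s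
    using that c by (intro divide_left_mono) auto
  have "infdist z C \<le> dist z p" using d by (auto intro: infdist_le)
  also have "dist z p = norm ((y - p) + ?v)" by (simp add: dist_norm)
  also have "\<dots> \<le> norm (y - p) + ((y - p) \<bullet> ?v) / norm (y - p) + (norm ?v)\<^sup>2 / (2 * norm (y - p))"
    using d c by (intro norm_add_le_quadratic) auto
  also have "\<dots> = ?r + ?\<xi> \<bullet> ?v + (norm ?v)\<^sup>2 / (2 * ?r)"
    using d unfolding dist_norm[symmetric] inner_scaleR_left by (simp only: divide_inverse_commute)
  finally have 1: "infdist z C \<le> ?r + ?\<xi> \<bullet> ?v + (norm ?v)\<^sup>2 / (2 * ?r)" .
  obtain x where x: "dist x y = \<delta>" "infdist x C = ?r + \<delta>"
    using y by (auto simp: extendable_def)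
  have "x = toward (- \<delta>) p y"
    using extendable_nearest[OF y(1) _ x] c by simp
  then have xy: "x - y = \<delta> *\<^sub>R ?\<xi>"
    using d by (simp add: toward_def divide_inverse algebra_simps)
  have "norm (x - y) = \<delta>" using x by (simp add: dist_norm)
  have "infdist x C \<le> infdist z C + dist x z" by (rule infdist_triangle)
  also have "dist x z = norm ((x - y) + (- ?v))" by (simp add: dist_norm)
  also have "\<dots> \<le> norm (x - y) + ((x - y) \<bullet> (- ?v)) / norm (x - y) + (norm (- ?v))\<^sup>2 / (2 * norm (x - y))"
    using x c by (intro norm_add_le_quadratic) auto
  also have "\<dots> = \<delta> - ?\<xi> \<bullet> ?v + (norm ?v)\<^sup>2 / (2 * \<delta>)"
    using c unfolding \<open>norm (x - y) = \<delta>\<close> unfolding xy inner_scaleR_left by (simp del: minus_diff_eq)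
  finally have "infdist x C \<le> infdist z C + (\<delta> - ?\<xi> \<bullet> ?v + (norm ?v)\<^sup>2 / (2 * \<delta>))" by simp
  then have 2: "?r \<le> infdist z C - ?\<xi> \<bullet> ?v + (norm ?v)\<^sup>2 / (2 * \<delta>)" using x by linarith
  show ?thesis using 1 2 q[of ?r] q[of \<delta>] c by linarith
qed

text \<open>At an extendable point the distance function is squeezed between two spheres, hence has
  two-sided quadratic error; comparing the two linear approximations around the midpoint gives a
  Lipschitz gradient.\<close>

lemma gradient_Lipschitz:
  fixes C :: "'a::euclidean_space set"
  assumes 1: "nearest C y p" "y \<in> extendable C \<delta>" "c \<le> infdist y C"
    and 2: "nearest C z q" "z \<in> extendable C \<delta>" "c \<le> infdist z C"
    and c: "0 < c" "c \<le> \<delta>"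
  shows "norm ((y - p) /\<^sub>R infdist y C - (z - q) /\<^sub>R infdist z C) \<le> norm (y - z) / c"
proof -
  define \<xi> \<eta> where "\<xi> = (y - p) /\<^sub>R infdist y C" and "\<eta> = (z - q) /\<^sub>R infdist z C"
  define m D where "m = (y + z) /\<^sub>R 2" and "D = (y - z) /\<^sub>R 2"
  have ym: "y = m + D" and zm: "z = m - D"
  proof -
    have "m + D = (1/2 + 1/2) *\<^sub>R y" "m - D = (1/2 + 1/2) *\<^sub>R z"
      by (simp_all add: m_def D_def algebra_simps del: scaleR_left.add flip: scaleR_add_left)
    then show "y = m + D" "z = m - D" by auto
  qed
  define K where "K = 1 / (2 * c)"
  \<comment> \<open>Evaluated at \<open>m + w\<close>, the linear approximations at \<open>y\<close>
    and at \<open>z\<close> differ by the affine function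
    \<open>a + (\<eta> - \<xi>) \<bullet> w\<close>, which is therefore of quadratic size.\<close>
  define a where "a = infdist z C - infdist y C + (\<xi> + \<eta>) \<bullet> D"
  have *: "\<bar>a + (\<eta> - \<xi>) \<bullet> w\<bar> \<le> K * (2 * (norm w)\<^sup>2 + 2 * (norm D)\<^sup>2)" for w
  proof -
    have "\<bar>infdist (m + w) C - infdist y C - \<xi> \<bullet> (w - D)\<bar> \<le> K * (norm (w - D))\<^sup>2"
      using infdist_quadratic_bound[OF 1(1,2) c 1(3), of "m + w"] by (simp add: \<xi>_def K_def ym)
    moreover have "\<bar>infdist (m + w) C - infdist z C - \<eta> \<bullet> (w + D)\<bar> \<le> K * (norm (w + D))\<^sup>2"
      using infdist_quadratic_bound[OF 2(1,2) c 2(3), of "m + w"] by (simp add: \<eta>_def K_def zm)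
    moreover have "a + (\<eta> - \<xi>) \<bullet> w = (infdist (m + w) C - infdist y C - \<xi> \<bullet> (w - D))
        - (infdist (m + w) C - infdist z C - \<eta> \<bullet> (w + D))"
      by (simp add: a_def inner_simps)
    moreover have "K * (2 * (norm w)\<^sup>2 + 2 * (norm D)\<^sup>2) = K * (norm (w - D))\<^sup>2 + K * (norm (w + D))\<^sup>2"
      by (simp add: power2_norm_eq_inner inner_simps inner_commute algebra_simps)
    ultimately show ?thesis by linarith
  qed
  \<comment> \<open>This \<open>w\<close> points along the gradient difference with length at most
    that of \<open>D\<close>, so both error terms stay of order \<open>D\<close> squared. Using
    \<open>w\<close> and \<open>- w\<close> together cancels the constant \<open>a\<close>.\<close>
  define w where "w = norm D *\<^sub>R sgn (\<eta> - \<xi>)"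
  have "norm w \<le> norm D" by (simp add: w_def norm_sgn)
  then have w: "(norm w)\<^sup>2 \<le> (norm D)\<^sup>2" by (intro power_mono) auto
  have ip: "(\<eta> - \<xi>) \<bullet> w = norm D * norm (\<eta> - \<xi>)"
    by (cases "\<eta> = \<xi>") (simp_all add: w_def sgn_div_norm dot_square_norm power2_eq_square)
  have "2 * ((\<eta> - \<xi>) \<bullet> w) \<le> 2 * (K * (2 * (norm w)\<^sup>2 + 2 * (norm D)\<^sup>2))"
    using *[of w] *[of "- w"] by (simp del: inner_diff_left)
  also have "\<dots> \<le> 2 * (K * (4 * (norm D)\<^sup>2))"
    using w c by (intro mult_left_mono) (auto simp: K_def)
  finally have le: "norm D * norm (\<eta> - \<xi>) \<le> norm D * (norm D * 2 / c)"
    unfolding ip using c by (simp add: K_def power2_eq_square field_simps)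
  \<comment> \<open>A factor \<open>norm D\<close> is about to be cancelled; if it vanishes, then
    \<open>y = z\<close>, and uniqueness of the nearest point makes the gradients equal.\<close>
  have zero: "norm (\<eta> - \<xi>) = 0" if "norm D = 0"
  proof -
    have "y = z" using that ym zm by simp
    then show ?thesis
      using 1 2 c extendable_nearest_unique[of y C \<delta> p q] by (simp add: \<xi>_def \<eta>_def)
  qed
  have "norm (\<eta> - \<xi>) \<le> norm D * 2 / c"
  proof (cases "norm D = 0")
    case False
    then have "0 < norm D" by simp
    with le show ?thesis by (metis mult_le_cancel_left_pos)
  qed (use zero in simp)
  then show ?thesis
    by (simp add: \<xi>_def \<eta>_def D_def norm_minus_commute)
qed

subsection \<open>Exceptional null sets\<close>

text \<open>Within a ball of finite volume only finitely many disjoint sets can have measure at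
  least 1/(k+1). Exhausting space by balls leaves countably many exceptional indices out of an
  uncountable interval.\<close>

lemma ex_null_in_disjoint_family:
  fixes P :: "real \<Rightarrow> 'a::euclidean_space set"
  assumes meas: "\<And>t. P t \<in> sets lborel" and disj: "disjoint_family_on P {0<..<R}" and "0 < R"
  shows "\<exists>t\<in>{0<..<R}. emeasure lborel (P t) = 0"
proof -
  let ?m = "\<lambda>n t. measure lborel (P t \<inter> ball 0 (real n))"
  have fm: "P t \<inter> ball 0 (real n) \<in> fmeasurable lborel" for n t
    by (intro fmeasurableI sets.Int meas emeasure_bounded_finite) (auto intro: bounded_subset)
  define J where "J n k = {t\<in>{0<..<R}. ?m n t \<ge> 1 / real (Suc k)}" for n k
  have "finite (J n k)" for n k
  proof (rule conjunct1, rule finite_if_finite_subsets_card_bdd)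
    fix F assume F: "F \<subseteq> J n k" "finite F"
    have "real (card F) * (1 / real (Suc k)) \<le> (\<Sum>t\<in>F. ?m n t)"
      using F by (intro sum_bounded_below) (auto simp only: J_def)
    also have "\<dots> = measure lborel (\<Union>t\<in>F. P t \<inter> ball 0 (real n))"
    proof (intro measure_UNION'[symmetric])
      show "pairwise (\<lambda>s t. disjnt (P s \<inter> ball 0 (real n)) (P t \<inter> ball 0 (real n))) F"
        unfolding pairwise_def disjnt_def
      proof (intro ballI impI)
        fix s t assume "s \<in> F" "t \<in> F" "s \<noteq> t"
        then have "P s \<inter> P t = {}"
          using disj F unfolding disjoint_family_on_def J_def by blast
        then show "P s \<inter> ball 0 (real n) \<inter> (P t \<inter> ball 0 (real n)) = {}" by blast
      qed
    qed (use F fm in auto)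
    also have "\<dots> \<le> measure lborel (ball 0 (real n) :: 'a set)"
      using F meas
      by (intro measure_mono_fmeasurable fmeasurableI emeasure_bounded_finite) (auto intro!: sets.finite_UN)
    finally have "real (card F) \<le> measure lborel (ball 0 (real n) :: 'a set) * real (Suc k)"
      by (simp add: field_simps)
    then show "card F \<le> nat \<lceil>measure lborel (ball 0 (real n) :: 'a set) * real (Suc k)\<rceil>"
      by linarith
  qed
  then have "countable (\<Union>n k. J n k)" by (simp add: countable_finite)
  moreover have "uncountable {0<..<R}" using \<open>0 < R\<close> by (simp add: uncountable_open_interval)
  ultimately obtain t where t: "t \<in> {0<..<R}" "t \<notin> (\<Union>n k. J n k)"
    by (meson countable_subset subsetI)
  have "P t \<inter> ball 0 (real n) \<in> null_sets lborel" for n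
  proof -
    have "\<not> 0 < ?m n t"
    proof
      assume "0 < ?m n t"
      then obtain k where "1 / real (Suc k) < ?m n t" using nat_approx_posE by blast
      then have "t \<in> J n k" unfolding J_def using t(1) by (simp del: of_nat_Suc)
      then show False using t by blast
    qed
    then have "?m n t = 0" by (simp add: antisym not_less)
    then show ?thesis
      using fm[of t n] emeasure_eq_measure2[OF fm[of t n]] by (simp add: null_sets_def fmeasurable_def)
  qed
  then have "(\<Union>n. P t \<inter> ball 0 (real n)) \<in> null_sets lborel" by (intro null_sets_UN)
  moreover have "(\<Union>n. P t \<inter> ball 0 (real n)) = P t"
    using reals_Archimedean2 by auto
  ultimately show ?thesis using t by auto
qed

text \<open>The translates of \<open>P\<close> by \<open>t *\<^sub>R v\<close> are pairwise
  disjoint, so one of them is null, and by translation invariance so is \<open>P\<close>. The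
  null-set lemmas on level sets, touching points and ambiguous nearest points come down to finding
  such a direction \<open>v\<close>.\<close>

lemma negligible_if_translates_disjoint:
  fixes P :: "'a::euclidean_space set"
  assumes "closed P" "0 < R" and disj: "\<And>x t. x \<in> P \<Longrightarrow> 0 < t \<Longrightarrow> t \<le> R \<Longrightarrow> x + t *\<^sub>R v \<notin> P"
  shows "negligible P"
proof -
  have "\<exists>t\<in>{0<..<R}. emeasure lborel ((+) (t *\<^sub>R v) ` P) = 0"
  proof (rule ex_null_in_disjoint_family)
    show "(+) (t *\<^sub>R v) ` P \<in> sets lborel" for t
      using \<open>closed P\<close> by (auto intro!: borel_closed closed_translation)
    have *: False if "x \<in> P" "y \<in> P" "s *\<^sub>R v + x = t *\<^sub>R v + y" "0 < s" "s < t" "t < R" for x y s t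
    proof -
      have "x = y + (t - s) *\<^sub>R v" using that(3) by (simp add: algebra_simps)
      then show False using disj[of y "t - s"] that by auto
    qed
    show "disjoint_family_on (\<lambda>t. (+) (t *\<^sub>R v) ` P) {0<..<R}"
      unfolding disjoint_family_on_def
    proof (intro ballI impI equals0I)
      fix s t x assume st: "s \<in> {0<..<R}" "t \<in> {0<..<R}" "s \<noteq> t"
        and "x \<in> (+) (s *\<^sub>R v) ` P \<inter> (+) (t *\<^sub>R v) ` P"
      then obtain y z where "y \<in> P" "z \<in> P" "s *\<^sub>R v + y = t *\<^sub>R v + z" by auto
      then show False
        using st *[of y z s t] *[of z y t s] by (cases s t rule: linorder_cases) simp_all
    qed
  qed fact
  then obtain t where "emeasure lborel ((+) (t *\<^sub>R v) ` P) = 0" by auto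
  then have "(+) (t *\<^sub>R v) ` P \<in> null_sets lborel"
    using \<open>closed P\<close> by (auto simp: null_sets_def intro!: borel_closed closed_translation)
  then have "negligible ((+) (t *\<^sub>R v) ` P)"
    by (simp add: negligible_iff_null_sets null_sets_completionI)
  then show ?thesis by (rule negligible_translation_rev)
qed

section \<open>Level sets, touching points and points with several nearest points\<close>

lemma countable_metric_dense_exists:
  obtains D :: "'a::euclidean_space set"
  where "countable D" "\<And>x e. 0 < e \<Longrightarrow> \<exists>d\<in>D. dist x d < e"
proof -
  obtain D :: "'a set" where D: "countable D" "\<And>X. open X \<Longrightarrow> X \<noteq> {} \<Longrightarrow> \<exists>d\<in>D. d \<in> X"
    using countable_dense_setE by blast
  show thesis
  proof
    show "\<exists>d\<in>D. dist x d < e" if "0 < e" for x e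
      using D(2)[of "ball x e"] that by auto
  qed fact
qed

text \<open>Moving straight towards a nearest point lowers the distance at unit speed; a velocity
  within 1/2 of that direction still lowers it at speed at least 1/2 and leaves the level set.
  Countably many velocities therefore suffice to sort all points of the level.\<close>

lemma negligible_infdist_level:
  fixes C :: "'a::euclidean_space set"
  assumes "closed C" "C \<noteq> {}" "0 < R"
  shows "negligible {x. infdist x C = R}"
proof -
  obtain D :: "'a set" where D: "countable D" "\<And>x e. 0 < e \<Longrightarrow> \<exists>d\<in>D. dist x d < e"
    using countable_metric_dense_exists by blast
  define P where "P v = {x. infdist x C = R \<and> (\<forall>t\<in>{0..R}. infdist (x + t *\<^sub>R v) C \<le> R - t / 2)}" for v
  have "negligible (P v)" for v
  proof (rule negligible_if_translates_disjoint[OF _ \<open>0 < R\<close>])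
    show "closed (P v)"
      unfolding P_def Ball_def
      by (intro closed_Collect_conj closed_Collect_all closed_Collect_imp closed_Collect_le
          closed_Collect_eq continuous_intros) auto
    show "x + t *\<^sub>R v \<notin> P v" if "x \<in> P v" "0 < t" "t \<le> R" for x t
    proof -
      have "infdist (x + t *\<^sub>R v) C \<le> R - t / 2" using that by (auto simp: P_def)
      then have "infdist (x + t *\<^sub>R v) C \<noteq> R" using that by linarith
      then show ?thesis by (auto simp: P_def)
    qed
  qed
  then have "negligible (\<Union>v\<in>D. P v)" using D by (auto intro: negligible_countable_Union)
  moreover have "{x. infdist x C = R} \<subseteq> (\<Union>v\<in>D. P v)"
  proof
    fix x assume "x \<in> {x. infdist x C = R}"
    then have x: "infdist x C = R" by simp
    obtain p where p: "p \<in> C" "dist x p = R"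
      using nearest_exists[of C x] assms x by (auto simp: nearest_def)
    obtain v where v: "v \<in> D" "dist ((p - x) /\<^sub>R R) v < 1 / 2" using D(2)[of "1/2"] by auto
    have "infdist (x + t *\<^sub>R v) C \<le> R - t / 2" if t: "0 \<le> t" "t \<le> R" for t
    proof -
      have "infdist (x + t *\<^sub>R v) C \<le> dist (x + t *\<^sub>R v) p" by (rule infdist_le) fact
      \<comment> \<open>The first summand is the exact motion towards \<open>p\<close>; the second
        is the error from replacing the true direction by \<open>v\<close>, of size at most
        \<open>t / 2\<close>.\<close>
      also have "x + t *\<^sub>R v - p = ((R - t) / R) *\<^sub>R (x - p) + t *\<^sub>R (v - (p - x) /\<^sub>R R)"
      proof -
        have "(R - t) / R = 1 - t / R" using \<open>0 < R\<close> by (simp add: field_simps)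
        then show ?thesis by (simp add: algebra_simps divide_inverse)
      qed
      then have "dist (x + t *\<^sub>R v) p \<le> norm (((R - t) / R) *\<^sub>R (x - p)) + norm (t *\<^sub>R (v - (p - x) /\<^sub>R R))"
        unfolding dist_norm by (metis norm_triangle_ineq)
      also have "norm (((R - t) / R) *\<^sub>R (x - p)) = R - t"
        using t p \<open>0 < R\<close> by (simp add: dist_norm)
      also have "norm (t *\<^sub>R (v - (p - x) /\<^sub>R R)) \<le> t * (1 / 2)"
        using t v unfolding norm_scaleR by (intro mult_mono) (auto simp: dist_norm norm_minus_commute)
      finally show ?thesis by simp
    qed
    then have "x \<in> P v" using x by (auto simp: P_def)
    then show "x \<in> (\<Union>v\<in>D. P v)" using v by blast
  qed
  ultimately show ?thesis by (rule negligible_subset)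
qed

text \<open>The mirror image of the level-set argument: the open ball of radius \<open>R\<close>
  around \<open>x\<close> misses \<open>C\<close>, so leaving \<open>p\<close> in roughly the
  direction of \<open>x\<close> leads out of \<open>C\<close>. This controls the images of points at
  distance exactly \<open>R = \<Delta>\<close>.\<close>

lemma negligible_touching_points:
  fixes C :: "'a::euclidean_space set"
  assumes "closed C" "0 < R"
  shows "negligible {p. \<exists>x. infdist x C = R \<and> nearest C x p}"
proof -
  obtain D :: "'a set" where D: "countable D" "\<And>x e. 0 < e \<Longrightarrow> \<exists>d\<in>D. dist x d < e"
    using countable_metric_dense_exists by blast
  define P where "P v = {p\<in>C. \<forall>t\<in>{0..R}. t / 2 \<le> infdist (p + t *\<^sub>R v) C}" for v
  have "negligible (P v)" for v
  proof (rule negligible_if_translates_disjoint[OF _ \<open>0 < R\<close>])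
    have "closed {p. \<forall>t\<in>{0..R}. t / 2 \<le> infdist (p + t *\<^sub>R v) C}"
      unfolding Ball_def
      by (intro closed_Collect_conj closed_Collect_all closed_Collect_imp closed_Collect_le
          closed_Collect_eq continuous_intros) auto
    then have "closed (C \<inter> {p. \<forall>t\<in>{0..R}. t / 2 \<le> infdist (p + t *\<^sub>R v) C})"
      using assms by (intro closed_Int)
    then show "closed (P v)" by (simp add: P_def Collect_conj_eq)
    show "x + t *\<^sub>R v \<notin> P v" if "x \<in> P v" "0 < t" "t \<le> R" for x t
    proof -
      have "t / 2 \<le> infdist (x + t *\<^sub>R v) C" using that by (auto simp: P_def)
      then have "infdist (x + t *\<^sub>R v) C \<noteq> 0" using that by linarith
      then show ?thesis by (auto simp: P_def)
    qed
  qed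
  then have "negligible (\<Union>v\<in>D. P v)" using D by (auto intro: negligible_countable_Union)
  moreover have "{p. \<exists>x. infdist x C = R \<and> nearest C x p} \<subseteq> (\<Union>v\<in>D. P v)"
  proof clarify
    fix p x assume R: "R = infdist x C" and "nearest C x p"
    then have p: "p \<in> C" "dist x p = infdist x C" by (auto simp: nearest_def)
    have pos: "0 < infdist x C" using R \<open>0 < R\<close> by simp
    obtain v where v: "v \<in> D" "dist ((x - p) /\<^sub>R infdist x C) v < 1 / 2" using D(2)[of "1/2"] by auto
    have "t / 2 \<le> infdist (p + t *\<^sub>R v) C" if t: "0 \<le> t" "t \<le> infdist x C" for t
    proof -
      let ?R = "infdist x C"
      have "x - (p + t *\<^sub>R v) = ((?R - t) / ?R) *\<^sub>R (x - p) - t *\<^sub>R (v - (x - p) /\<^sub>R ?R)"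
      proof -
        have "(?R - t) / ?R = 1 - t / ?R" using pos by (simp add: field_simps)
        then show ?thesis by (simp add: algebra_simps divide_inverse)
      qed
      then have "dist x (p + t *\<^sub>R v) \<le> norm (((?R - t) / ?R) *\<^sub>R (x - p)) + norm (t *\<^sub>R (v - (x - p) /\<^sub>R ?R))"
        unfolding dist_norm by (metis norm_triangle_ineq4)
      also have "norm (((?R - t) / ?R) *\<^sub>R (x - p)) = ?R - t"
        using t p pos by (simp add: dist_norm)
      also have "norm (t *\<^sub>R (v - (x - p) /\<^sub>R ?R)) \<le> t * (1 / 2)"
        using t v unfolding norm_scaleR by (intro mult_mono) (auto simp: dist_norm norm_minus_commute)
      finally show ?thesis using infdist_triangle[of x C "p + t *\<^sub>R v"] by simp
    qed
    then have "p \<in> P v" using p R by (auto simp: P_def)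
    then show "p \<in> (\<Union>v\<in>D. P v)" using v by blast
  qed
  ultimately show ?thesis by (rule negligible_subset)
qed

text \<open>The nearest-point relation is monotone, so a set of points having nearest points in each of
  two separated balls is disjoint from its translates along the line joining the centres.\<close>

lemma negligible_nonunique_nearest:
  fixes C :: "'a::euclidean_space set"
  assumes "closed C"
  shows "negligible {x. \<exists>p q. nearest C x p \<and> nearest C x q \<and> p \<noteq> q}"
proof -
  obtain D :: "'a set" where D: "countable D" "\<And>x e. 0 < e \<Longrightarrow> \<exists>d\<in>D. dist x d < e"
    using countable_metric_dense_exists by blast
  define S where "S a n = {x. \<exists>p. p \<in> C \<inter> cball a (1 / real (Suc n)) \<and> (p, x) \<in> {(p, x). dist x p = infdist x C}}"
    for a n
  have closed_S: "closed (S a n)" for a n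
    unfolding S_def case_prod_beta using assms
    by (intro closed_compact_projection closed_Int_compact closed_Collect_eq continuous_intros) auto
  define I where "I = {(a, b, n) \<in> D \<times> D \<times> UNIV. 2 / real (Suc n) < dist a b}"
  have "negligible (S a n \<inter> S b n)" if ab: "2 / real (Suc n) < dist a b" for a b n
  proof (rule negligible_if_translates_disjoint[OF _ zero_less_one])
    show "closed (S a n \<inter> S b n)" using closed_S by auto
    fix x and t :: real
    assume "x \<in> S a n \<inter> S b n" and t: "0 < t" "t \<le> 1"
    then obtain q where q: "q \<in> C" "dist b q \<le> 1 / real (Suc n)" "dist x q = infdist x C"
      by (auto simp: S_def)
    show "x + t *\<^sub>R (b - a) \<notin> S a n \<inter> S b n"
    proof
      let ?y = "x + t *\<^sub>R (b - a)"
      assume "?y \<in> S a n \<inter> S b n"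
      then obtain p where p: "p \<in> C" "dist a p \<le> 1 / real (Suc n)" "dist ?y p = infdist ?y C"
        by (auto simp: S_def)
      have "dist ?y p \<le> dist ?y q" "dist x q \<le> dist x p"
        using p q by (auto intro: infdist_le)
      \<comment> \<open>Adding the squared minimality inequalities cancels all pure squares and
        leaves monotonicity of the nearest-point relation. It contradicts \<open>q - p\<close> being
        close to \<open>b - a\<close>.\<close>
      then have "(norm (?y - p))\<^sup>2 + (norm (x - q))\<^sup>2 \<le> (norm (?y - q))\<^sup>2 + (norm (x - p))\<^sup>2"
        by (intro add_mono power_mono) (auto simp: dist_norm)
      then have "2 * t * ((b - a) \<bullet> (q - p)) \<le> 0"
        by (simp add: power2_norm_eq_inner inner_simps inner_commute algebra_simps)
      then have "(b - a) \<bullet> (q - p) \<le> 0" using t by (simp add: mult_le_0_iff)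
      moreover have "(b - a) \<bullet> (q - p) = (norm (b - a))\<^sup>2 + (b - a) \<bullet> (q - b) + (b - a) \<bullet> (a - p)"
        by (simp add: power2_norm_eq_inner inner_simps inner_commute)
      moreover have "(b - a) \<bullet> (q - b) \<ge> - (norm (b - a) * (1 / real (Suc n)))"
        "(b - a) \<bullet> (a - p) \<ge> - (norm (b - a) * (1 / real (Suc n)))"
      proof -
        have "\<bar>(b - a) \<bullet> w\<bar> \<le> norm (b - a) * (1 / real (Suc n))" if "norm w \<le> 1 / real (Suc n)" for w
          using Cauchy_Schwarz_ineq2[of "b - a" w] that
          by (meson mult_left_mono norm_ge_zero order_trans)
        from this[of "q - b"] this[of "a - p"] p q show "(b - a) \<bullet> (q - b) \<ge> - (norm (b - a) * (1 / real (Suc n)))"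
        "(b - a) \<bullet> (a - p) \<ge> - (norm (b - a) * (1 / real (Suc n)))"
          by (auto simp: dist_norm norm_minus_commute)
      qed
      ultimately have "norm (b - a) * norm (b - a) \<le> norm (b - a) * (2 / real (Suc n))"
        by (simp add: power2_eq_square)
      moreover have "0 < norm (b - a)" "2 / real (Suc n) < norm (b - a)"
        using ab by (auto simp: dist_norm norm_minus_commute)
      ultimately show False by (metis mult_le_cancel_left_pos not_less)
    qed
  qed
  moreover have "countable I"
    by (rule countable_subset[of _ "D \<times> D \<times> UNIV"]) (use D in \<open>auto simp: I_def\<close>)
  ultimately have "negligible (\<Union>(a, b, n)\<in>I. S a n \<inter> S b n)"
    by (intro negligible_countable_Union) (auto simp: I_def)
  moreover have "{x. \<exists>p q. nearest C x p \<and> nearest C x q \<and> p \<noteq> q} \<subseteq> (\<Union>(a, b, n)\<in>I. S a n \<inter> S b n)"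
  proof clarify
    fix x p q assume pq: "nearest C x p" "nearest C x q" "p \<noteq> q"
    then have "0 < dist p q / 4" by simp
    \<comment> \<open>With a radius below a quarter of the gap, two approximation errors still leave
      the centres more than two radii apart, as \<open>I\<close> demands.\<close>
    then obtain n where n: "1 / real (Suc n) < dist p q / 4" using nat_approx_posE by blast
    obtain a b where a: "a \<in> D" "dist p a < 1 / real (Suc n)" and b: "b \<in> D" "dist q b < 1 / real (Suc n)"
      using D(2)[of "1 / real (Suc n)"] by (metis of_nat_0_less_iff zero_less_Suc zero_less_divide_1_iff)
    have "dist p q \<le> dist p a + dist a b + dist q b"
      using dist_triangle[of p q a] dist_triangle[of a q b] by (simp add: dist_commute)
    then have "2 / real (Suc n) < dist a b" using a b n by simp
    moreover have "x \<in> S c n" if "nearest C x r" "dist r c < 1 / real (Suc n)" for c r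
      using that by (auto simp: S_def nearest_def dist_commute intro!: exI[of _ r])
    ultimately have "(a, b, n) \<in> I" "x \<in> S a n \<inter> S b n"
      using a b pq by (auto simp: I_def)
    then show "x \<in> (\<Union>(a, b, n)\<in>I. S a n \<inter> S b n)" by blast
  qed
  ultimately show ?thesis by (rule negligible_subset)
qed

subsection \<open>Preservation of null sets\<close>

text \<open>The map subtracts \<open>s\<close> times the gradient, so it is Lipschitz on each layer
  where the distance to \<open>C\<close> is at least 1/(n+1), and Lipschitz maps between spaces of
  equal dimension preserve null sets. The layers exhaust \<open>Z\<close>.\<close>

lemma negligible_toward_extendable:
  fixes C :: "'a::euclidean_space set" and \<pi> :: "'a \<Rightarrow> 'a"
  assumes \<pi>: "\<And>x. nearest C x (\<pi> x)" and "0 < \<delta>"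
    and Z: "negligible Z" "Z \<subseteq> extendable C \<delta>" "\<And>z. z \<in> Z \<Longrightarrow> 0 < infdist z C"
  shows "negligible ((\<lambda>z. toward s (\<pi> z) z) ` Z)"
proof -
  define Y where "Y n = {z \<in> Z. 1 / real (Suc n) \<le> infdist z C}" for n
  define \<xi> where "\<xi> z = (z - \<pi> z) /\<^sub>R infdist z C" for z
  have T: "toward s (\<pi> z) z = z - s *\<^sub>R \<xi> z" for z
    using \<pi>[of z] by (simp add: toward_def \<xi>_def nearest_def divide_inverse algebra_simps)
  have "negligible ((\<lambda>z. toward s (\<pi> z) z) ` Y n)" for n
  proof (rule negligible_locally_Lipschitz_image[OF order_refl])
    show "negligible (Y n)" using Z by (auto simp: Y_def intro: negligible_subset)
    define c where "c = min \<delta> (1 / real (Suc n))"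
    have c: "0 < c" "c \<le> \<delta>" "c \<le> 1 / real (Suc n)" using \<open>0 < \<delta>\<close> by (auto simp: c_def)
    have "norm (toward s (\<pi> y) y - toward s (\<pi> z) z) \<le> (1 + \<bar>s\<bar> / c) * norm (y - z)"
      if "y \<in> Y n" "z \<in> Y n" for y z
    proof -
      have "norm (\<xi> y - \<xi> z) \<le> norm (y - z) / c"
        unfolding \<xi>_def
        using that Z c by (intro gradient_Lipschitz[OF \<pi> _ _ \<pi>, where \<delta> = \<delta>]) (auto simp: Y_def)
      then have "norm (s *\<^sub>R (\<xi> y - \<xi> z)) \<le> \<bar>s\<bar> * (norm (y - z) / c)"
        unfolding norm_scaleR by (intro mult_left_mono) auto
      moreover have eq: "toward s (\<pi> y) y - toward s (\<pi> z) z = (y - z) - s *\<^sub>R (\<xi> y - \<xi> z)"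
        by (simp add: T algebra_simps)
      ultimately show ?thesis
        unfolding eq distrib_right
        using norm_triangle_ineq4[of "y - z" "s *\<^sub>R (\<xi> y - \<xi> z)"] by simp
    qed
    then show "\<exists>T B. open T \<and> x \<in> T \<and>
        (\<forall>y\<in>Y n \<inter> T. norm (toward s (\<pi> y) y - toward s (\<pi> x) x) \<le> B * norm (y - x))" if "x \<in> Y n" for x
      using that by (intro exI[of _ UNIV] exI[of _ "1 + \<bar>s\<bar> / c"]) auto
  qed
  then have "negligible (\<Union>n. (\<lambda>z. toward s (\<pi> z) z) ` Y n)" by (rule negligible_Union_nat)
  moreover have "(\<lambda>z. toward s (\<pi> z) z) ` Z \<subseteq> (\<Union>n. (\<lambda>z. toward s (\<pi> z) z) ` Y n)"
  proof clarify
    fix z assume "z \<in> Z"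
    then obtain n where "1 / real (Suc n) < infdist z C" using Z(3) nat_approx_posE by blast
    then have "z \<in> Y n" using \<open>z \<in> Z\<close> by (simp add: Y_def)
    then show "toward s (\<pi> z) z \<in> (\<Union>n. (\<lambda>z. toward s (\<pi> z) z) ` Y n)" by blast
  qed
  ultimately show ?thesis by (rule negligible_subset)
qed

text \<open>The map is not Lipschitz near points that cannot be extended away from \<open>C\<close>. Stopping it
  at a time \<open>\<epsilon>\<close> first puts these points into the set of points extendable by exactly
  \<open>\<epsilon>\<close>; such sets are disjoint for distinct \<open>\<epsilon>\<close>, so some choice of \<open>\<epsilon>\<close> gives a null set.\<close>

lemma negligible_toward_image:
  fixes C :: "'a::euclidean_space set" and \<pi> :: "'a \<Rightarrow> 'a"
  assumes \<pi>: "\<And>x. nearest C x (\<pi> x)" and "0 \<le> \<Delta>"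
    and Z: "negligible Z" "\<And>z. z \<in> Z \<Longrightarrow> \<Delta> < infdist z C"
  shows "negligible ((\<lambda>z. toward \<Delta> (\<pi> z) z) ` Z)"
proof (cases "\<Delta> = 0")
  case False
  then have "0 < \<Delta>" using \<open>0 \<le> \<Delta>\<close> by simp
  \<comment> \<open>Points extendable by \<open>t\<close> and by nothing more. Removing a sequence
    of larger extensions is enough by antitonicity, and it keeps the set Borel.\<close>
  define P where "P t = extendable C t - (\<Union>n. extendable C (t + 1 / real (Suc n)))" for t
  define G where "G s z = toward s (\<pi> z) z" for s z
  have [measurable]: "extendable C t \<in> sets borel" for t
    using closed_extendable by (rule borel_closed)
  have meas: "P t \<in> sets borel" for t
    unfolding P_def by measurable
  have "\<exists>\<epsilon>\<in>{0<..<\<Delta>}. emeasure lborel (P \<epsilon>) = 0"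
  proof (rule ex_null_in_disjoint_family[OF _ _ \<open>0 < \<Delta>\<close>])
    show "P t \<in> sets lborel" for t using meas by simp
    have "x \<notin> P s" if "x \<in> P t" "0 < s" "s < t" for x s t
    proof -
      have "0 < t - s" using that by simp
      then obtain n where "1 / real (Suc n) < t - s" using nat_approx_posE by blast
      then have "extendable C t \<subseteq> extendable C (s + 1 / real (Suc n))"
        using that by (intro extendable_antimono) auto
      then show ?thesis using that by (auto simp: P_def)
    qed
    then show "disjoint_family_on P {0<..<\<Delta>}"
      unfolding disjoint_family_on_def by (metis disjoint_iff greaterThanLessThan_iff linorder_cases)
  qed
  then obtain \<epsilon> where \<epsilon>: "0 < \<epsilon>" "\<epsilon> < \<Delta>" and "emeasure lborel (P \<epsilon>) = 0" by auto
  then have negl_P: "negligible (P \<epsilon>)"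
    using meas by (auto simp: negligible_iff_null_sets intro!: null_sets_completionI null_setsI)
  \<comment> \<open>Images of those points of \<open>Z\<close> that can themselves be extended by a
    positive amount; the Lipschitz case makes them null. The remaining points of \<open>Z\<close>
    land in \<open>P \<epsilon>\<close>.\<close>
  define E where "E = (\<Union>n. G \<epsilon> ` (Z \<inter> extendable C (1 / real (Suc n))))"
  have "negligible E"
    unfolding E_def
  proof (rule negligible_Union_nat)
    show "negligible (G \<epsilon> ` (Z \<inter> extendable C (1 / real (Suc n))))" for n
      unfolding G_def
      by (rule negligible_toward_extendable[OF \<pi>, where \<delta> = "1 / real (Suc n)"])
        (use Z \<open>0 < \<Delta>\<close> in \<open>auto intro: negligible_subset less_trans\<close>)
  qed
  have sub: "G \<epsilon> ` Z \<subseteq> P \<epsilon> \<union> E"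
  proof clarify
    fix x assume "x \<in> Z" "G \<epsilon> x \<notin> E"
    have x: "nearest C x (\<pi> x)" "\<epsilon> < infdist x C" using \<pi> Z \<open>x \<in> Z\<close> \<epsilon> by force+
    let ?z = "G \<epsilon> x"
    have z: "nearest C ?z (\<pi> x)" "infdist ?z C = infdist x C - \<epsilon>" "?z \<in> extendable C \<epsilon>"
      using nearest_toward[OF x(1), of \<epsilon>] toward_in_extendable[OF x(1), of \<epsilon>] x \<epsilon> by (auto simp: G_def)
    \<comment> \<open>An extension of \<open>?z\<close> by more than \<open>\<epsilon>\<close> must
      follow the ray through \<open>x\<close>, hence extends \<open>x\<close> as well and puts
      \<open>?z\<close> into \<open>E\<close>.\<close>
    have "?z \<notin> extendable C (\<epsilon> + 1 / real (Suc n))" for n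
    proof
      assume "?z \<in> extendable C (\<epsilon> + 1 / real (Suc n))"
      then obtain w where w: "dist w ?z = \<epsilon> + 1 / real (Suc n)" "infdist w C = infdist ?z C + (\<epsilon> + 1 / real (Suc n))"
        by (auto simp: extendable_def)
      have d: "dist w (\<pi> x) > 1 / real (Suc n)"
        using infdist_le[of "\<pi> x" C w] w z x \<epsilon> by (simp add: nearest_def)
      have "w = toward (- (\<epsilon> + 1 / real (Suc n))) (\<pi> x) ?z"
        using extendable_nearest[OF z(1) _ w] x z by simp
      also have "\<dots> = toward (- (1 / real (Suc n))) (\<pi> x) x"
        using x by (simp add: G_def toward_toward nearest_def)
      finally have "dist w x = 1 / real (Suc n)"
        using x \<epsilon> dist_toward_source[of x "\<pi> x" "- (1 / real (Suc n))"]
        by (force simp: nearest_def dist_commute)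
      moreover have "infdist w C = infdist x C + 1 / real (Suc n)" using w z by simp
      ultimately have "x \<in> extendable C (1 / real (Suc n))" by (auto simp: extendable_def)
      then show False using \<open>x \<in> Z\<close> \<open>G \<epsilon> x \<notin> E\<close> by (auto simp: E_def)
    qed
    then show "?z \<in> P \<epsilon>" using z by (auto simp: P_def)
  qed
  \<comment> \<open>The second stage starts from points extendable by \<open>\<epsilon>\<close>,
    where the selection is forced to continue towards \<open>\<pi> x\<close>; the Lipschitz case
    then covers the remaining time.\<close>
  have eq: "G \<Delta> x = G (\<Delta> - \<epsilon>) (G \<epsilon> x)" and mem: "G \<epsilon> x \<in> extendable C \<epsilon>" "0 < infdist (G \<epsilon> x) C"
    if "x \<in> Z" for x
  proof -
    have x: "nearest C x (\<pi> x)" "\<epsilon> < infdist x C" using \<pi> Z that \<epsilon> by force+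
    have "\<pi> (G \<epsilon> x) = \<pi> x"
      using nearest_on_extendable_segment[OF x(1) \<epsilon>(1) x(2) \<pi>] by (simp add: G_def)
    then show "G \<Delta> x = G (\<Delta> - \<epsilon>) (G \<epsilon> x)"
      using x toward_toward[of \<epsilon> x "\<pi> x" "\<Delta> - \<epsilon>"] by (simp add: G_def nearest_def)
    show "G \<epsilon> x \<in> extendable C \<epsilon>" "0 < infdist (G \<epsilon> x) C"
      using nearest_toward[OF x(1), of \<epsilon>] toward_in_extendable[OF x(1), of \<epsilon>] x \<epsilon> by (auto simp: G_def)
  qed
  have "negligible (G \<epsilon> ` Z)"
    using sub negl_P \<open>negligible E\<close> by (blast intro: negligible_subset negligible_Un)
  then have "negligible ((\<lambda>z. toward (\<Delta> - \<epsilon>) (\<pi> z) z) ` (G \<epsilon> ` Z))"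
    using mem by (intro negligible_toward_extendable[OF \<pi> \<epsilon>(1)]) auto
  also have "(\<lambda>z. toward (\<Delta> - \<epsilon>) (\<pi> z) z) ` (G \<epsilon> ` Z) = G \<Delta> ` Z"
    using eq by (auto simp: image_image G_def[symmetric])
  finally show ?thesis by (simp add: G_def[abs_def])
qed (use Z in simp)

subsection \<open>Polar coordinates\<close>

lemma nn_integral_inverse_power_tail:
  fixes a :: real
  assumes "0 < a" "0 < d"
  shows "(\<integral>\<^sup>+t. ennreal (1 / t ^ Suc d) * indicator {a..} t \<partial>lborel) = ennreal (1 / (real d * a ^ d))"
proof -
  have "(\<integral>\<^sup>+t. ennreal (1 / t ^ Suc d) * indicator {a..} t \<partial>lborel) = ennreal (0 - (- (1 / (real d * a ^ d))))"
  proof (rule nn_integral_FTC_atLeast)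
    show "((\<lambda>t. - (1 / (real d * t ^ d))) has_real_derivative 1 / t ^ Suc d) (at t)" if "a \<le> t" for t
      using that assms
      by (auto intro!: derivative_eq_intros simp: power2_eq_square field_simps)
        (simp add: power_Suc[symmetric] del: power_Suc)
    have "filterlim (\<lambda>t::real. t ^ d) at_top at_top"
      using filterlim_pow_at_top[OF \<open>0 < d\<close> filterlim_ident] .
    then have "filterlim (\<lambda>t::real. real d * t ^ d) at_top at_top"
      using assms by (intro filterlim_tendsto_pos_mult_at_top[OF tendsto_const]) auto
    then have "((\<lambda>t::real. - inverse (real d * t ^ d)) \<longlongrightarrow> - 0) at_top"
      by (intro tendsto_minus tendsto_inverse_0_at_top)
    then show "((\<lambda>t::real. - (1 / (real d * t ^ d))) \<longlongrightarrow> 0) at_top"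
      by (simp add: inverse_eq_divide)
  qed (use assms in auto)
  then show ?thesis by simp
qed

lemma nn_integral_lborel_scale:
  fixes f :: "'a::euclidean_space \<Rightarrow> ennreal"
  assumes [measurable]: "f \<in> borel_measurable borel" and "0 < c"
  shows "(\<integral>\<^sup>+x. f (c *\<^sub>R x) \<partial>lborel) = ennreal (1 / c ^ DIM('a)) * (\<integral>\<^sup>+x. f x \<partial>lborel)"
proof -
  have "(\<integral>\<^sup>+x. f (c *\<^sub>R x) \<partial>lborel) = (\<integral>\<^sup>+x. f (c *\<^sub>R x)
      \<partial>density (distr lborel borel (\<lambda>x::'a. 0 + (1 / c) *\<^sub>R x)) (\<lambda>_. ennreal (\<bar>1 / c\<bar> ^ DIM('a))))"
    using \<open>0 < c\<close> by (subst lborel_affine[of "1 / c" 0]) auto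
  also have "\<dots> = ennreal (\<bar>1 / c\<bar> ^ DIM('a)) * (\<integral>\<^sup>+x. f x \<partial>lborel)"
    using \<open>0 < c\<close> by (simp add: nn_integral_density nn_integral_distr nn_integral_cmult)
  finally show ?thesis using \<open>0 < c\<close> by (simp add: power_divide)
qed

text \<open>Polar coordinates without a surface measure: directions are averaged over the unit ball.\<close>

lemma nn_integral_polar_origin:
  fixes f :: "'a::euclidean_space \<Rightarrow> ennreal"
  assumes [measurable]: "f \<in> borel_measurable borel"
  shows "(\<integral>\<^sup>+y. f y \<partial>lborel) = ennreal (DIM('a)) * (\<integral>\<^sup>+x. indicator (cball 0 1) x *
     (\<integral>\<^sup>+s. ennreal (s ^ (DIM('a) - 1)) * indicator {0<..} s * f (s *\<^sub>R sgn x) \<partial>lborel) \<partial>lborel)"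
proof -
  let ?d = "DIM('a)"
  have d: "Suc (?d - 1) = ?d" "0 < ?d" by auto
  have nz: "AE x in lborel. x \<noteq> (0::'a)" by (rule AE_lborel_singleton)
  \<comment> \<open>The integrand after substituting s = |x| \<tau> on the ray: \<open>sgn x\<close>
    becomes \<open>x\<close>, and the weight and Jacobian combine to |x|^d \<tau>^(d-1).\<close>
  define k where "k x \<tau> = indicator (cball 0 1) x * ennreal (norm x ^ ?d) * (ennreal (\<tau> ^ (?d - 1)) * indicator {0<..} \<tau> * f (\<tau> *\<^sub>R x))"
    for x :: 'a and \<tau> :: real
  have [measurable]: "cball (0::'a) 1 \<in> sets borel" by (rule borel_closed) simp
  have [measurable]: "(\<lambda>(x, \<tau>). k x \<tau>) \<in> borel_measurable (lborel \<Otimes>\<^sub>M lborel)"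
    unfolding k_def by measurable
  have "(\<integral>\<^sup>+x. indicator (cball 0 1) x *
     (\<integral>\<^sup>+s. ennreal (s ^ (?d - 1)) * indicator {0<..} s * f (s *\<^sub>R sgn x) \<partial>lborel) \<partial>lborel)
     = (\<integral>\<^sup>+x. (\<integral>\<^sup>+\<tau>. k x \<tau> \<partial>lborel) \<partial>lborel)"
  proof (rule nn_integral_cong_AE, use nz in eventually_elim)
    case (elim x)
    have "(\<integral>\<^sup>+s. ennreal (s ^ (?d - 1)) * indicator {0<..} s * f (s *\<^sub>R sgn x) \<partial>lborel)
        = ennreal \<bar>norm x\<bar> * (\<integral>\<^sup>+\<tau>. ennreal ((0 + norm x * \<tau>) ^ (?d - 1)) * indicator {0<..} (0 + norm x * \<tau>)
            * f ((0 + norm x * \<tau>) *\<^sub>R sgn x) \<partial>lborel)"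
      using elim by (intro nn_integral_real_affine) auto
    also have "\<dots> = (\<integral>\<^sup>+\<tau>. ennreal (norm x) * (ennreal ((norm x * \<tau>) ^ (?d - 1)) * indicator {0<..} (norm x * \<tau>)
            * f ((norm x * \<tau>) *\<^sub>R sgn x)) \<partial>lborel)"
      by (simp add: nn_integral_cmult)
    also have "\<dots> = (\<integral>\<^sup>+\<tau>. ennreal (norm x ^ ?d) * (ennreal (\<tau> ^ (?d - 1)) * indicator {0<..} \<tau> * f (\<tau> *\<^sub>R x)) \<partial>lborel)"
    proof (rule nn_integral_cong)
      fix \<tau> :: real
      show "ennreal (norm x) * (ennreal ((norm x * \<tau>) ^ (?d - 1)) * indicator {0<..} (norm x * \<tau>)
            * f ((norm x * \<tau>) *\<^sub>R sgn x)) = ennreal (norm x ^ ?d) * (ennreal (\<tau> ^ (?d - 1)) * indicator {0<..} \<tau> * f (\<tau> *\<^sub>R x))"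
      proof (cases "0 < \<tau>")
        case True
        have "(norm x * \<tau>) *\<^sub>R sgn x = \<tau> *\<^sub>R x" using elim by (simp add: sgn_div_norm)
        moreover have "norm x * (norm x * \<tau>) ^ (?d - 1) = norm x ^ ?d * \<tau> ^ (?d - 1)"
          unfolding power_mult_distrib by (metis d(1) mult.assoc power_Suc)
        then have "ennreal (norm x) * ennreal ((norm x * \<tau>) ^ (?d - 1)) = ennreal (norm x ^ ?d) * ennreal (\<tau> ^ (?d - 1))"
          using True by (simp add: ennreal_mult[symmetric])
        ultimately show ?thesis using True elim by (simp add: mult.assoc[symmetric])
      next
        case False
        then have "\<not> 0 < norm x * \<tau>" by (simp add: zero_less_mult_iff)
        then show ?thesis using False by simp
      qed
    qed
    finally show ?case by (simp add: k_def mult.assoc nn_integral_cmult)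
  qed
  also have "\<dots> = (\<integral>\<^sup>+\<tau>. (\<integral>\<^sup>+x. k x \<tau> \<partial>lborel) \<partial>lborel)"
    by (rule lborel_pair.Fubini'[symmetric]) measurable
  \<comment> \<open>For fixed \<tau> > 0 substitute y = \<tau> x, with Jacobian \<tau>^(-d). The
    condition |x| \<le> 1 becomes |y| \<le> \<tau>, and the total power of \<tau> is -(d+1).\<close>
  also have "\<dots> = (\<integral>\<^sup>+\<tau>. (\<integral>\<^sup>+y. ennreal (norm y ^ ?d) * f y * (ennreal (1 / \<tau> ^ Suc ?d) * indicator {0<..} \<tau> * indicator {norm y..} \<tau>) \<partial>lborel) \<partial>lborel)"
  proof (rule nn_integral_cong)
    fix \<tau> :: real
    show "(\<integral>\<^sup>+x. k x \<tau> \<partial>lborel) = (\<integral>\<^sup>+y. ennreal (norm y ^ ?d) * f y * (ennreal (1 / \<tau> ^ Suc ?d) * indicator {0<..} \<tau> * indicator {norm y..} \<tau>) \<partial>lborel)"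
    proof (cases "0 < \<tau>")
      case True
      define g where "g y = ennreal (norm y ^ ?d) * f y * (ennreal (1 / \<tau>) * indicator {norm y..} \<tau>)" for y :: 'a
      have [measurable]: "g \<in> borel_measurable borel"
      proof -
        have "g = (\<lambda>y. ennreal (norm y ^ ?d) * f y * (ennreal (1 / \<tau>) * indicator {y. norm y \<le> \<tau>} y))"
          by (auto simp: g_def fun_eq_iff indicator_def)
        also have "\<dots> \<in> borel_measurable borel" by measurable
        finally show ?thesis .
      qed
      have "k x \<tau> = g (\<tau> *\<^sub>R x)" for x
      proof -
        have "norm (\<tau> *\<^sub>R x) ^ ?d * (1 / \<tau>) = norm x ^ ?d * \<tau> ^ (?d - 1)"
          using True unfolding norm_scaleR power_mult_distrib power_minus_mult[OF d(2), symmetric] by simp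
        then have eq: "ennreal (norm x ^ ?d) * ennreal (\<tau> ^ (?d - 1)) = ennreal (norm (\<tau> *\<^sub>R x) ^ ?d) * ennreal (1 / \<tau>)"
          using True by (simp add: ennreal_mult[symmetric] del: norm_scaleR)
        have ind: "(indicator {norm (\<tau> *\<^sub>R x)..} \<tau> :: ennreal) = indicator (cball 0 1) x"
          using True by (auto simp: indicator_def)
        have "k x \<tau> = (ennreal (norm x ^ ?d) * ennreal (\<tau> ^ (?d - 1))) * (indicator (cball 0 1) x * f (\<tau> *\<^sub>R x))"
          using True unfolding k_def by (simp add: mult_ac)
        also have "\<dots> = g (\<tau> *\<^sub>R x)"
          unfolding eq g_def ind by (simp only: mult_ac)
        finally show ?thesis .
      qed
      then have "(\<integral>\<^sup>+x. k x \<tau> \<partial>lborel) = ennreal (1 / \<tau> ^ ?d) * (\<integral>\<^sup>+y. g y \<partial>lborel)"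
        using True by (simp add: nn_integral_lborel_scale)
      also have "\<dots> = (\<integral>\<^sup>+y. ennreal (1 / \<tau> ^ ?d) * g y \<partial>lborel)" by (simp add: nn_integral_cmult)
      also have "\<dots> = (\<integral>\<^sup>+y. ennreal (norm y ^ ?d) * f y * (ennreal (1 / \<tau> ^ Suc ?d) * indicator {0<..} \<tau> * indicator {norm y..} \<tau>) \<partial>lborel)"
      proof (rule nn_integral_cong)
        fix y :: 'a
        have "ennreal (1 / \<tau> ^ Suc ?d) = ennreal (1 / \<tau> ^ ?d) * ennreal (1 / \<tau>)"
          using True by (simp add: ennreal_mult[symmetric] mult.commute)
        then show "ennreal (1 / \<tau> ^ ?d) * g y = ennreal (norm y ^ ?d) * f y * (ennreal (1 / \<tau> ^ Suc ?d) * indicator {0<..} \<tau> * indicator {norm y..} \<tau>)"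
          using True unfolding g_def by (simp add: mult_ac)
      qed
      finally show ?thesis .
    qed (simp add: k_def)
  qed
  also have "\<dots> = (\<integral>\<^sup>+y. (\<integral>\<^sup>+\<tau>. ennreal (norm y ^ ?d) * f y * (ennreal (1 / \<tau> ^ Suc ?d) * indicator {0<..} \<tau> * indicator {norm y..} \<tau>) \<partial>lborel) \<partial>lborel)"
  proof (rule lborel_pair.Fubini')
    have "(\<lambda>(y, \<tau>). ennreal (norm y ^ ?d) * f y * (ennreal (1 / \<tau> ^ Suc ?d) * indicator {0<..} \<tau> * indicator {norm y..} \<tau>))
       = (\<lambda>z. ennreal (norm (fst z) ^ ?d) * f (fst z) * (ennreal (1 / snd z ^ Suc ?d) * indicator {0<..} (snd z) * indicator {z. norm (fst z) \<le> snd z} z))"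
      by (auto simp: fun_eq_iff indicator_def)
    also have "\<dots> \<in> borel_measurable (lborel \<Otimes>\<^sub>M lborel)" by measurable
    finally show "(\<lambda>(y, \<tau>). ennreal (norm y ^ ?d) * f y * (ennreal (1 / \<tau> ^ Suc ?d) * indicator {0<..} \<tau> * indicator {norm y..} \<tau>))
      \<in> borel_measurable (lborel \<Otimes>\<^sub>M lborel)" .
  qed
  \<comment> \<open>The integral of \<tau>^(-d-1) over \<tau> \<ge> |y| is 1/(d |y|^d). It cancels
    |y|^d, and the leftover 1/d explains the factor \<open>DIM('a)\<close> in the formula.\<close>
  also have "\<dots> = (\<integral>\<^sup>+y. ennreal (1 / ?d) * f y \<partial>lborel)"
  proof (rule nn_integral_cong_AE, use nz in eventually_elim)
    case (elim y)
    have "(\<integral>\<^sup>+\<tau>. ennreal (norm y ^ ?d) * f y * (ennreal (1 / \<tau> ^ Suc ?d) * indicator {0<..} \<tau> * indicator {norm y..} \<tau>) \<partial>lborel)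
      = ennreal (norm y ^ ?d) * f y * (\<integral>\<^sup>+\<tau>. ennreal (1 / \<tau> ^ Suc ?d) * indicator {0<..} \<tau> * indicator {norm y..} \<tau> \<partial>lborel)"
      by (rule nn_integral_cmult) simp
    also have "(\<integral>\<^sup>+\<tau>. ennreal (1 / \<tau> ^ Suc ?d) * indicator {0<..} \<tau> * indicator {norm y..} \<tau> \<partial>lborel)
      = (\<integral>\<^sup>+\<tau>. ennreal (1 / \<tau> ^ Suc ?d) * indicator {norm y..} \<tau> \<partial>lborel)"
    proof (rule nn_integral_cong)
      fix \<tau> :: real
      have "0 < \<tau>" if "norm y \<le> \<tau>" using elim that by (metis less_le_trans zero_less_norm_iff)
      then show "ennreal (1 / \<tau> ^ Suc ?d) * indicator {0<..} \<tau> * indicator {norm y..} \<tau>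
        = ennreal (1 / \<tau> ^ Suc ?d) * indicator {norm y..} \<tau>"
        by (auto simp: indicator_def)
    qed
    also have "\<dots> = ennreal (1 / (real ?d * norm y ^ ?d))"
      using elim by (intro nn_integral_inverse_power_tail) auto
    also have "ennreal (norm y ^ ?d) * f y * ennreal (1 / (real ?d * norm y ^ ?d)) = ennreal (norm y ^ ?d * (1 / (real ?d * norm y ^ ?d))) * f y"
      by (subst ennreal_mult) (auto simp: mult_ac)
    also have "norm y ^ ?d * (1 / (real ?d * norm y ^ ?d)) = 1 / ?d" using elim by simp
    finally show ?case .
  qed
  also have "\<dots> = ennreal (1 / ?d) * (\<integral>\<^sup>+y. f y \<partial>lborel)" by (rule nn_integral_cmult) simp
  finally show ?thesis by (simp add: mult.assoc[symmetric] ennreal_mult[symmetric])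
qed

lemma nn_integral_polar:
  fixes f :: "'a::euclidean_space \<Rightarrow> ennreal"
  assumes [measurable]: "f \<in> borel_measurable borel"
  shows "(\<integral>\<^sup>+y. f y \<partial>lborel) = ennreal (DIM('a)) * (\<integral>\<^sup>+x. indicator (cball 0 1) x *
     (\<integral>\<^sup>+s. ennreal (s ^ (DIM('a) - 1)) * indicator {0<..} s * f (h + s *\<^sub>R sgn x) \<partial>lborel) \<partial>lborel)"
proof -
  have "(\<integral>\<^sup>+y. f y \<partial>lborel) = (\<integral>\<^sup>+y. f y \<partial>distr lborel borel ((+) h))"
    by (simp add: lborel_distr_plus)
  also have "\<dots> = (\<integral>\<^sup>+y. f (h + y) \<partial>lborel)" by (simp add: nn_integral_distr)
  finally show ?thesis using nn_integral_polar_origin[of "\<lambda>y. f (h + y)"] by simp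
qed

subsection \<open>Volume bounds\<close>

text \<open>On each ray from \<open>h\<close> the map is a translation of the radius by
  \<open>\<Delta>\<close>, so lengths are kept and only the polar weight drops from t^(d-1) to (t -
  \<Delta>)^(d-1). The strict bound in \<open>far\<close> excludes the sphere that would collapse to
  \<open>h\<close> when \<open>R = \<Delta>\<close>.\<close>

lemma
  fixes B :: "'a::euclidean_space set"
  assumes B [measurable]: "B \<in> sets borel" and R: "0 \<le> \<Delta>" "\<Delta> \<le> R" "0 < R"
    and far: "\<And>x. x \<in> B \<Longrightarrow> R \<le> dist x h" "\<And>x. x \<in> B \<Longrightarrow> \<Delta> < dist x h"
  shows borel_toward_image: "toward \<Delta> h ` B \<in> sets borel"
    and emeasure_toward_image_ge:
      "ennreal (((R - \<Delta>) / R) ^ (DIM('a) - 1)) * emeasure lborel B \<le> emeasure lborel (toward \<Delta> h ` B)"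
proof -
  let ?d = "DIM('a)" and ?S = "toward \<Delta> h ` B"
  \<comment> \<open>Off \<open>h\<close> the image is the preimage of \<open>B\<close> under the
    inverse move, a Borel map; this is what makes it Borel.\<close>
  have img: "?S = {y. y \<noteq> h \<and> toward (- \<Delta>) h y \<in> B}"
  proof safe
    fix x assume "x \<in> B"
    with far have x: "\<Delta> < dist x h" by auto
    then have "dist (toward \<Delta> h x) h = dist x h - \<Delta>"
      using R by (subst dist_toward_target) auto
    then show "toward \<Delta> h x = h \<Longrightarrow> False" using x by simp
    show "toward (- \<Delta>) h (toward \<Delta> h x) \<in> B" using x \<open>x \<in> B\<close> by (simp add: toward_toward)
  next
    fix y assume y: "y \<noteq> h" "toward (- \<Delta>) h y \<in> B"
    then have "- \<Delta> < dist y h" using R by (smt (verit) zero_less_dist_iff)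
    then have "y = toward \<Delta> h (toward (- \<Delta>) h y)" by (simp add: toward_toward)
    then show "y \<in> ?S" using y by blast
  qed
  show meas [measurable]: "?S \<in> sets borel"
    unfolding img toward_def by measurable
  define k where "k = ((R - \<Delta>) / R) ^ (?d - 1)"
  have k: "0 \<le> k" using R by (simp add: k_def)
  define inner where "inner S x = (\<integral>\<^sup>+s. ennreal (s ^ (?d - 1)) * indicator {0<..} s * indicator S (h + s *\<^sub>R sgn x) \<partial>lborel)"
    for S and x :: 'a
  have [measurable]: "cball (0::'a) 1 \<in> sets borel" by (rule borel_closed) simp
  have [measurable]: "inner S \<in> borel_measurable borel" if [measurable]: "S \<in> sets borel" for S
    unfolding inner_def by measurable
  have polar: "emeasure lborel S = ennreal ?d * (\<integral>\<^sup>+x. indicator (cball 0 1) x * inner S x \<partial>lborel)"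
    if [measurable]: "S \<in> sets borel" for S
    using nn_integral_polar[of "indicator S" h] by (simp add: inner_def)
  have le: "ennreal k * inner B x \<le> inner ?S x" if "x \<noteq> 0" for x
  proof -
    have "ennreal k * inner B x
      = (\<integral>\<^sup>+t. ennreal k * (ennreal (t ^ (?d - 1)) * indicator {0<..} t * indicator B (h + t *\<^sub>R sgn x)) \<partial>lborel)"
      unfolding inner_def by (rule nn_integral_cmult[symmetric]) measurable
    also have "\<dots> \<le> (\<integral>\<^sup>+t. ennreal ((- \<Delta> + 1 * t) ^ (?d - 1)) * indicator {0<..} (- \<Delta> + 1 * t)
        * indicator ?S (h + (- \<Delta> + 1 * t) *\<^sub>R sgn x) \<partial>lborel)"
    proof (rule nn_integral_mono)
      fix t :: real
      show "ennreal k * (ennreal (t ^ (?d - 1)) * indicator {0<..} t * indicator B (h + t *\<^sub>R sgn x))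
        \<le> ennreal ((- \<Delta> + 1 * t) ^ (?d - 1)) * indicator {0<..} (- \<Delta> + 1 * t)
        * indicator ?S (h + (- \<Delta> + 1 * t) *\<^sub>R sgn x)"
      proof (cases "0 < t \<and> h + t *\<^sub>R sgn x \<in> B")
        case True
        let ?x = "h + t *\<^sub>R sgn x"
        have dx: "dist ?x h = t" using True \<open>x \<noteq> 0\<close> by (simp add: dist_norm norm_sgn)
        then have t: "R \<le> t" "\<Delta> < t" using far[of ?x] True by auto
        have "toward \<Delta> h ?x = h + (- \<Delta> + t) *\<^sub>R sgn x"
          using True dx by (simp add: toward_def algebra_simps)
        then have "h + (- \<Delta> + t) *\<^sub>R sgn x \<in> ?S" using True by (metis imageI)
        moreover have "(R - \<Delta>) / R * t \<le> - \<Delta> + t"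
          using t R mult_left_mono[of R t \<Delta>] by (simp add: field_simps)
        then have "k * t ^ (?d - 1) \<le> (- \<Delta> + t) ^ (?d - 1)"
          unfolding k_def power_mult_distrib[symmetric] using True R by (intro power_mono) auto
        then have "ennreal k * ennreal (t ^ (?d - 1)) \<le> ennreal ((- \<Delta> + t) ^ (?d - 1))"
          using True k by (simp add: ennreal_mult[symmetric] ennreal_leI)
        ultimately show ?thesis using True t by simp
      qed auto
    qed
    also have "\<dots> = inner ?S x"
      unfolding inner_def
      by (subst nn_integral_real_affine[of _ 1 "- \<Delta>"]) auto
    finally show ?thesis .
  qed
  have "ennreal k * emeasure lborel B = ennreal ?d * (\<integral>\<^sup>+x. ennreal k * (indicator (cball 0 1) x * inner B x) \<partial>lborel)"
    by (simp add: polar[OF B] nn_integral_cmult mult.left_commute)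
  also have "\<dots> \<le> ennreal ?d * (\<integral>\<^sup>+x. indicator (cball 0 1) x * inner ?S x \<partial>lborel)"
  proof (intro mult_left_mono nn_integral_mono_AE)
    have "AE x in lborel. x \<noteq> (0::'a)" by (rule AE_lborel_singleton)
    then show "AE x in lborel. ennreal k * (indicator (cball 0 1) x * inner B x) \<le> indicator (cball 0 1) x * inner ?S x"
    proof eventually_elim
      case (elim x)
      then show ?case using le[of x] by (auto simp: indicator_def)
    qed
  qed auto
  also have "\<dots> = emeasure lborel ?S" using polar[OF meas] by simp
  finally show "ennreal k * emeasure lborel B \<le> emeasure lborel ?S" .
qed

text \<open>Each cell of a Voronoi partition is moved towards its own centre, and the moved cells
  stay disjoint. Ties are broken by the partition, not by a given selection, so the conclusion
  offers a Borel set inside the image of the nearest-point relation.\<close>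

lemma emeasure_toward_finite_ge:
  fixes F K :: "'a::euclidean_space set"
  assumes F: "finite F" and K [measurable]: "K \<in> sets borel"
    and R: "0 \<le> \<Delta>" "\<Delta> \<le> R" "0 < R"
    and far: "\<And>x. x \<in> K \<Longrightarrow> R \<le> infdist x F" "\<And>x. x \<in> K \<Longrightarrow> \<Delta> < infdist x F"
  shows "\<exists>M\<in>sets borel. M \<subseteq> {toward \<Delta> p x | x p. x \<in> K \<and> nearest F x p} \<and>
    ennreal (((R - \<Delta>) / R) ^ (DIM('a) - 1)) * emeasure lborel K \<le> emeasure lborel M"
proof -
  let ?k = "ennreal (((R - \<Delta>) / R) ^ (DIM('a) - 1))"
  obtain n and h :: "nat \<Rightarrow> 'a" where h: "F = h ` {i. i < n}"
    using finite_imp_nat_seg_image_inj_on[OF F] by blast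
  \<comment> \<open>Indices from \<open>n\<close> on get the empty cell, so that
    \<open>disjointed\<close> applies and assigns each tie to the smallest index.\<close>
  define V where "V i = (if i < n then {x \<in> K. dist x (h i) = infdist x F} else {})" for i
  define W where "W = disjointed V"
  have "V i \<in> sets borel" for i
  proof -
    have "{x. dist x (h i) = infdist x F} \<in> sets borel"
      by (intro borel_closed closed_Collect_eq continuous_intros)
    then show ?thesis using K by (auto simp: V_def Collect_conj_eq)
  qed
  then have W: "W i \<in> sets borel" for i
    
    using sets.range_disjointed_sets[of V borel] unfolding W_def by (simp add: image_subset_iff)
  have disj: "disjoint_family W" unfolding W_def by (rule disjoint_family_disjointed)
  have near: "i < n" "x \<in> K" "nearest F x (h i)" if "x \<in> W i" for x i
    using that disjointed_subset[of V i] h by (auto simp: W_def V_def nearest_def split: if_splits)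
  have "K \<subseteq> (\<Union>i. V i)"
  proof
    fix x assume "x \<in> K"
    \<comment> \<open>By convention \<open>infdist\<close> to the empty set is 0, which the lower
      bounds rule out.\<close>
    then have "F \<noteq> {}" using far R by (force simp: infdist_def)
    then obtain p where "nearest F x p" using nearest_exists finite_imp_closed[OF F] by blast
    then show "x \<in> (\<Union>i. V i)" using h \<open>x \<in> K\<close> by (auto simp: nearest_def V_def)
  qed
  then have UW: "(\<Union>i. W i) = K" unfolding W_def UN_disjointed_eq by (auto simp: V_def split: if_splits)
  let ?T = "\<lambda>i. toward \<Delta> (h i) ` W i"
  have T: "?T i \<in> sets borel" "?k * emeasure lborel (W i) \<le> emeasure lborel (?T i)" for i
  proof -
    have "R \<le> dist x (h i)" "\<Delta> < dist x (h i)" if "x \<in> W i" for x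
      using near[OF that] far[of x] by (auto simp: nearest_def)
    then show "?T i \<in> sets borel" "?k * emeasure lborel (W i) \<le> emeasure lborel (?T i)"
      using borel_toward_image[OF W R] emeasure_toward_image_ge[OF W R] by blast+
  qed
  \<comment> \<open>The distance of \<open>?z\<close> to \<open>F\<close> is less than that of
    \<open>x\<close> by \<open>\<Delta>\<close>, so \<open>x\<close> extends \<open>?z\<close> by
    \<open>\<Delta>\<close>. The nearest point \<open>h j\<close> of \<open>?z\<close> determines
    this extension, and it is \<open>y\<close>.\<close>
  have inj: "x = y" if x: "x \<in> W i" and y: "y \<in> W j" and eq: "toward \<Delta> (h i) x = toward \<Delta> (h j) y" for x y i j
  proof -
    let ?z = "toward \<Delta> (h j) y"
    have fx: "\<Delta> < infdist x F" and fy: "\<Delta> < infdist y F" using near[OF x] near[OF y] far by auto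
    have zi: "infdist ?z F = infdist x F - \<Delta>"
      using nearest_toward[OF near(3)[OF x], of \<Delta>] R fx eq by simp
    have zj: "nearest F ?z (h j)"
      using nearest_toward[OF near(3)[OF y], of \<Delta>] R fy by simp
    have "dist x ?z = \<Delta>"
      using dist_toward_source[of x "h i" \<Delta>] near(3)[OF x] fx R eq by (force simp: nearest_def)
    then have "x = toward (- \<Delta>) (h j) ?z"
      using zi fx by (intro extendable_nearest[OF zj]) auto
    also have "\<dots> = y" using near(3)[OF y] fy by (simp add: toward_toward nearest_def)
    finally show ?thesis .
  qed
  have "disjoint_family ?T"
    unfolding disjoint_family_on_def
  proof (intro ballI impI equals0I)
    fix i j z assume "i \<noteq> j" "z \<in> ?T i \<inter> ?T j"
    then obtain x y where "x \<in> W i" "y \<in> W j" "toward \<Delta> (h i) x = toward \<Delta> (h j) y" by auto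
    with inj have "W i \<inter> W j \<noteq> {}" by blast
    then show False using disj \<open>i \<noteq> j\<close> by (auto simp: disjoint_family_on_def)
  qed
  then have "emeasure lborel (\<Union>i. ?T i) = (\<Sum>i. emeasure lborel (?T i))"
    using T by (intro suminf_emeasure[symmetric]) auto
  moreover have "?k * emeasure lborel K = (\<Sum>i. ?k * emeasure lborel (W i))"
    using suminf_emeasure[of W lborel] W disj UW by (simp add: image_subset_iff)
  moreover have "(\<Sum>i. ?k * emeasure lborel (W i)) \<le> (\<Sum>i. emeasure lborel (?T i))"
    using T by (intro suminf_le) auto
  ultimately have "?k * emeasure lborel K \<le> emeasure lborel (\<Union>i. ?T i)" by simp
  moreover have "(\<Union>i. ?T i) \<in> sets borel" using T by auto
  moreover have "(\<Union>i. ?T i) \<subseteq> {toward \<Delta> p x | x p. x \<in> K \<and> nearest F x p}"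
    using near by blast
  ultimately show ?thesis by blast
qed

text \<open>The centres range over finite approximations of \<open>C\<close>; the images of the resulting
  approximate nearest-point pairs are compact and decrease to the image under the exact map.\<close>

lemma
  fixes C K :: "'a::euclidean_space set" and \<pi> :: "'a \<Rightarrow> 'a"
  assumes C: "closed C" and \<pi>: "\<And>x. nearest C x (\<pi> x)"
    and K: "compact K" "\<And>x p. x \<in> K \<Longrightarrow> nearest C x p \<Longrightarrow> p = \<pi> x"
    and R: "0 \<le> \<Delta>" "\<Delta> \<le> R" "0 < R"
    and far: "\<And>x. x \<in> K \<Longrightarrow> R \<le> infdist x C" "\<And>x. x \<in> K \<Longrightarrow> \<Delta> < infdist x C"
  shows compact_toward_image: "compact ((\<lambda>x. toward \<Delta> (\<pi> x) x) ` K)"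
    and emeasure_toward_compact_ge: "ennreal (((R - \<Delta>) / R) ^ (DIM('a) - 1)) * emeasure lborel K
      \<le> emeasure lborel ((\<lambda>x. toward \<Delta> (\<pi> x) x) ` K)"
proof -
  let ?k = "ennreal (((R - \<Delta>) / R) ^ (DIM('a) - 1))" and ?T = "(\<lambda>x. toward \<Delta> (\<pi> x) x) ` K"
  define \<Phi> where "\<Phi> z = toward \<Delta> (snd z) (fst z)" for z :: "'a \<times> 'a"
  \<comment> \<open>Pairs that are nearest up to slack \<open>e\<close>. With slack 0 this is the
    graph of \<open>\<pi>\<close> over \<open>K\<close>, by uniqueness of nearest points on
    \<open>K\<close>.\<close>
  define D where "D e = {z \<in> K \<times> C. dist (fst z) (snd z) \<le> infdist (fst z) C + e}" for e :: real
  obtain b where b: "\<And>x. x \<in> K \<Longrightarrow> norm x \<le> b"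
    using compact_imp_bounded[OF K(1)] by (auto simp: bounded_iff)
  have compact_D: "compact (D e)" for e
  proof -
    have "D e = (K \<times> (C \<inter> cball 0 (infdist 0 C + 2 * b + e))) \<inter> {z. dist (fst z) (snd z) \<le> infdist (fst z) C + e}"
    proof safe
      fix x p assume "(x, p) \<in> D e"
      then have x: "x \<in> K" "p \<in> C" "dist x p \<le> infdist x C + e" by (auto simp: D_def)
      moreover have "norm p \<le> norm x + dist x p"
        using norm_triangle_sub[of p x] by (simp add: dist_norm norm_minus_commute)
      moreover have "infdist x C \<le> infdist 0 C + norm x"
        using infdist_triangle[of x C 0] by simp
      ultimately show "p \<in> cball 0 (infdist 0 C + 2 * b + e)" using b[of x] by simp
    qed (auto simp: D_def)
    also have "compact \<dots>"
      using K C by (intro compact_Int_closed compact_Times closed_Int_compact closed_Collect_le continuous_intros) auto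
    finally show ?thesis .
  qed
  have cont: "continuous_on (D e) \<Phi>" for e
  proof -
    \<comment> \<open>Points of \<open>K\<close> keep a positive distance from \<open>C\<close>, so
      the normalisation in \<open>toward\<close> never divides by zero.\<close>
    have "dist (fst z) (snd z) \<noteq> 0" if "z \<in> D e" for z
      using that far(2)[of "fst z"] R infdist_le[of "snd z" C "fst z"] by (auto simp: D_def)
    then show ?thesis
      unfolding \<Phi>_def toward_def by (intro continuous_intros) auto
  qed
  have T: "\<Phi> ` D 0 = ?T"
  proof -
    have "D 0 = (\<lambda>x. (x, \<pi> x)) ` K"
    proof safe
      fix x p assume "(x, p) \<in> D 0"
      then have "x \<in> K" "nearest C x p"
        using infdist_le[of p C x] by (auto simp: D_def nearest_def)
      then show "(x, p) \<in> (\<lambda>x. (x, \<pi> x)) ` K" using K(2) by blast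
    qed (use \<pi> in \<open>auto simp: D_def nearest_def\<close>)
    then show ?thesis by (simp add: \<Phi>_def image_image)
  qed
  then show "compact ?T" using compact_continuous_image[OF cont compact_D] by metis
  define M where "M n = \<Phi> ` D (1 / real (Suc n))" for n
  have compact_M: "compact (M n)" for n
    unfolding M_def by (rule compact_continuous_image[OF cont compact_D])
  have D_mono: "D d \<subseteq> D e" if "d \<le> e" for d e
    using that by (auto simp: D_def)
  have anti: "1 / real (Suc n) \<le> 1 / real (Suc m)" if "m \<le> n" for m n
    using that by (intro divide_left_mono) auto
  have "?k * emeasure lborel K \<le> emeasure lborel (M n)" for n
  proof -
    define e where "e = 1 / real (Suc n)"
    have "0 < e" by (simp add: e_def)
    obtain X where X: "X \<subseteq> K" "finite X" "K \<subseteq> (\<Union>x\<in>X. ball x (e / 2))"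
      by (rule compactE_image[OF K(1), of K "\<lambda>x. ball x (e / 2)"]) (use \<open>0 < e\<close> in auto)
    \<comment> \<open>Nearest points of an e/2-net of \<open>K\<close> lie in \<open>C\<close>, so
      distances to \<open>F\<close> are at least those to \<open>C\<close> and the lower bounds
      survive. Passing to a net point and back costs e/2 twice.\<close>
    define F where "F = \<pi> ` X"
    have "F \<subseteq> C" using \<pi> by (auto simp: F_def nearest_def)
    have up: "infdist x F \<le> infdist x C + e" and low: "infdist x C \<le> infdist x F" if "x \<in> K" for x
    proof -
      have "x \<in> (\<Union>y\<in>X. ball y (e / 2))" using X(3) that by blast
      then obtain y where y: "y \<in> X" "dist y x < e / 2" by auto
      have "infdist x F \<le> dist x (\<pi> y)" using y by (intro infdist_le) (auto simp: F_def)
      also have "\<dots> \<le> dist x y + dist y (\<pi> y)" by (rule dist_triangle)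
      also have "dist y (\<pi> y) = infdist y C" using \<pi> by (simp add: nearest_def)
      also have "infdist y C \<le> infdist x C + dist y x" by (rule infdist_triangle)
      finally show "infdist x F \<le> infdist x C + e" using y by (simp add: dist_commute)
      show "infdist x C \<le> infdist x F" using \<open>F \<subseteq> C\<close> y by (intro infdist_mono) (auto simp: F_def)
    qed
    obtain N where N: "N \<in> sets borel" "N \<subseteq> {toward \<Delta> p x | x p. x \<in> K \<and> nearest F x p}"
      "?k * emeasure lborel K \<le> emeasure lborel N"
      using emeasure_toward_finite_ge[of F K \<Delta> R] X K R far low
      by (force simp: F_def borel_compact intro: order_trans less_le_trans)
    have "N \<subseteq> M n"
    proof
      fix z assume "z \<in> N"
      then obtain x p where z: "z = toward \<Delta> p x" "x \<in> K" "nearest F x p" using N by blast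
      then have "(x, p) \<in> D e" using \<open>F \<subseteq> C\<close> up[of x] by (auto simp: D_def nearest_def)
      then show "z \<in> M n" by (auto simp: M_def e_def \<Phi>_def z intro!: image_eqI[of _ _ "(x, p)"])
    qed
    then show ?thesis
      using N compact_M[of n] by (intro order_trans[OF N(3)] emeasure_mono) (auto intro: borel_compact)
  qed
  then have "?k * emeasure lborel K \<le> (INF n. emeasure lborel (M n))" by (intro INF_greatest)
  also have "\<dots> = emeasure lborel (\<Inter>n. M n)"
  proof (rule INF_emeasure_decseq)
    show "decseq M"
      unfolding decseq_def M_def by (metis D_mono anti image_mono)
    show "emeasure lborel (M n) \<noteq> \<infinity>" for n
      using emeasure_bounded_finite[OF compact_imp_bounded[OF compact_M]] by (metis infinity_ennreal_def less_irrefl)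
  qed (use compact_M in \<open>auto intro: borel_compact\<close>)
  also have "\<dots> \<le> emeasure lborel ?T"
  proof (rule emeasure_mono)
    show "(\<Inter>n. M n) \<subseteq> ?T"
    proof
      fix y assume y: "y \<in> (\<Inter>n. M n)"
      \<comment> \<open>The approximate pairs mapped to \<open>y\<close> form nested nonempty
        compact sets as the slack shrinks; a common element has slack 0.\<close>
      let ?Q = "\<lambda>n. {z \<in> D (1 / real (Suc n)). \<Phi> z = y}"
      have "\<Inter>(range ?Q) \<noteq> {}"
      proof (rule compact_nest)
        show "compact (?Q n)" for n
        proof -
          have "closed (?Q n)"
            by (rule continuous_closed_preimage_constant[OF cont compact_imp_closed[OF compact_D]])
          then have "compact (D (1 / real (Suc n)) \<inter> ?Q n)" by (rule compact_Int_closed[OF compact_D])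
          then show ?thesis by (simp add: Int_def)
        qed
        show "?Q n \<noteq> {}" for n
        proof -
          have "y \<in> \<Phi> ` D (1 / real (Suc n))" using y unfolding M_def by blast
          then show ?thesis by blast
        qed
        show "?Q n \<subseteq> ?Q m" if "m \<le> n" for m n using D_mono[OF anti[OF that]] by blast
      qed
      then obtain z where z: "\<And>n. z \<in> D (1 / real (Suc n))" "\<Phi> z = y" by auto
      have "dist (fst z) (snd z) \<le> infdist (fst z) C + e" if "0 < e" for e
        using nat_approx_posE[OF that] z(1) by (smt (verit) D_def mem_Collect_eq)
      then have "dist (fst z) (snd z) \<le> infdist (fst z) C" by (rule field_le_epsilon)
      then have "z \<in> D 0" using z(1)[of 0] by (auto simp: D_def)
      then show "y \<in> ?T" using z T by blast
    qed
  qed (use \<open>compact ?T\<close> in \<open>auto intro: borel_compact\<close>)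
  finally show "?k * emeasure lborel K \<le> emeasure lborel ?T" .
qed

section \<open>Passage from compact to measurable sets\<close>

theorem theorem2:
  fixes H A :: "'a::euclidean_space set" and \<pi> :: "'a \<Rightarrow> 'a" and R \<Delta> :: real
  assumes "H \<noteq> {}"
    and "nearest_selection H \<pi>"
    and "A \<in> sets lebesgue"
    and "set_distance H A \<ge> ereal R" and "R \<ge> \<Delta>" and "\<Delta> \<ge> 0" and "R > 0"
  shows "approach_map H \<pi> \<Delta> ` A \<in> sets lebesgue \<and>
         emeasure lebesgue (approach_map H \<pi> \<Delta> ` A)
           \<ge> ennreal (((R - \<Delta>) / R) ^ (DIM('a) - 1)) * emeasure lebesgue A"
proof -
  let ?k = "ennreal (((R - \<Delta>) / R) ^ (DIM('a) - 1))" and ?T = "approach_map H \<pi> \<Delta>"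
  define C where "C = closure H"
  have C: "closed C" "C \<noteq> {}" using assms(1) by (auto simp: C_def)
  have infdist_C: "infdist x H = infdist x C" for x
    by (simp add: C_def infdist_eq_setdist)
  have \<pi>: "nearest C x (\<pi> x)" for x
    using assms(2) by (simp add: nearest_selection_def nearest_def C_def[symmetric] infdist_C)
  have A: "R \<le> infdist x C" if "x \<in> A" for x
  proof -
    have "ereal R \<le> ereal (infdist x H)"
      using assms(4) INF_lower[OF that, of "\<lambda>x. ereal (infdist x H)"] unfolding set_distance_def
      by (rule order_trans)
    then show ?thesis by (simp add: infdist_C)
  qed
  define G where "G x = toward \<Delta> (\<pi> x) x" for x
  have T_far: "?T x = G x" if "\<Delta> < infdist x C" for x
    using that by (simp add: approach_map_def infdist_C G_def toward_def dist_norm norm_minus_commute divide_inverse)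
  have T_near: "?T x = \<pi> x" if "\<not> \<Delta> < infdist x C" for x
    using that by (simp add: approach_map_def infdist_C)
  define N1 where "N1 = {x. \<exists>p q. nearest C x p \<and> nearest C x q \<and> p \<noteq> q}"
  have N1: "negligible N1" unfolding N1_def by (rule negligible_nonunique_nearest[OF C(1)])
  define A1 where "A1 = A \<inter> {x. \<Delta> < infdist x C}"
  have "{x. \<Delta> < infdist x C} \<in> sets borel"
    by (intro borel_open open_Collect_less continuous_intros)
  then have A1: "A1 \<in> sets lebesgue" unfolding A1_def using assms(3) by auto
  then have "A1 - N1 \<in> sets lebesgue" using N1 by (auto simp: negligible_iff_null_sets)
  then obtain S N2 where S: "fsigma S" "N2 \<in> null_sets lebesgue" "S \<union> N2 = A1 - N1"
    using lebesgue_set_almost_fsigma by metis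
  obtain K :: "nat \<Rightarrow> 'a set" where "range K \<subseteq> Collect compact" and US: "S = (\<Union>n. K n)"
    using S(1) unfolding fsigma_Union_compact by blast
  then have K: "compact (K n)" for n by blast
  \<comment> \<open>Partial unions give an increasing sequence, so continuity of measure from below
    recovers the measure of \<open>S\<close>; on the image side monotonicity is enough.\<close>
  define L where "L n = (\<Union>i\<le>n. K i)" for n
  have L: "compact (L n)" "L n \<subseteq> A1 - N1" for n using K US S by (auto simp: L_def)
  have UL: "(\<Union>n. L n) = S" using US by (auto simp: L_def)
  have LG: "compact (G ` L n)" "?k * emeasure lborel (L n) \<le> emeasure lborel (G ` L n)" for n
  proof -
    have far: "R \<le> infdist x C" "\<Delta> < infdist x C" and unique: "nearest C x p \<Longrightarrow> p = \<pi> x"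
      if "x \<in> L n" for x p
      using that L[of n] A \<pi> by (auto simp: A1_def N1_def)
    then show "compact (G ` L n)" "?k * emeasure lborel (L n) \<le> emeasure lborel (G ` L n)"
      unfolding G_def
      using compact_toward_image[OF C(1) \<pi> L(1) unique assms(6,5,7) far]
        emeasure_toward_compact_ge[OF C(1) \<pi> L(1) unique assms(6,5,7) far] by blast+
  qed
  define Z where "Z = A1 - S"
  have "Z \<subseteq> N1 \<union> N2" using S by (auto simp: Z_def)
  then have Z: "negligible Z"
    using N1 S by (metis negligible_Un negligible_iff_null_sets negligible_subset)
  \<comment> \<open>Nonempty only if \<open>R = \<Delta>\<close>; it then consists of the points of
    \<open>A\<close> at distance exactly \<open>R\<close>, which jump onto their selected nearest
    points.\<close>
  define B where "B = A - A1"
  have B: "infdist x C = R" "R = \<Delta>" if "x \<in> B" for x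
    using that A[of x] assms(5) by (auto simp: B_def A1_def)
  have "negligible (G ` Z)"
    unfolding G_def
    by (rule negligible_toward_image[OF \<pi>]) (use assms Z in \<open>auto simp: Z_def A1_def\<close>)
  moreover have "\<pi> ` B \<subseteq> {p. \<exists>x. infdist x C = R \<and> nearest C x p}" using B(1) \<pi> by blast
  then have "negligible (\<pi> ` B)"
    by (rule negligible_subset[OF negligible_touching_points[OF C(1) \<open>R > 0\<close>]])
  ultimately have negl: "negligible (G ` Z \<union> \<pi> ` B)" by (rule negligible_Un)
  have "?T ` A = ?T ` S \<union> ?T ` Z \<union> ?T ` B" using S by (auto simp: Z_def B_def A1_def)
  also have "?T ` S = G ` S" using S T_far by (intro image_cong) (auto simp: A1_def)
  also have "?T ` Z = G ` Z" using T_far by (intro image_cong) (auto simp: Z_def A1_def)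
  also have "?T ` B = \<pi> ` B" using T_near by (intro image_cong) (auto simp: B_def A1_def)
  also have "G ` S = (\<Union>n. G ` L n)" using UL by blast
  finally have TA: "?T ` A = (\<Union>n. G ` L n) \<union> (G ` Z \<union> \<pi> ` B)" by (simp add: Un_assoc)
  have borel: "L n \<in> sets borel" "G ` L n \<in> sets borel" for n
    using L LG by (auto intro: borel_compact)
  have meas: "?T ` A \<in> sets lebesgue"
  proof -
    have "(\<Union>n. G ` L n) \<in> sets lebesgue" using borel by auto
    then show ?thesis unfolding TA using negligible_imp_sets[OF negl] by (rule sets.Un)
  qed
  \<comment> \<open>Source and image require separate null sets: the touching points absorb the
    image of \<open>B\<close>, and the level set at distance \<open>R\<close> absorbs
    \<open>B\<close> itself.\<close>
  have "A \<subseteq> S \<union> (Z \<union> {x. infdist x C = R})" using B by (auto simp: Z_def B_def)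
  moreover have NZ: "Z \<union> {x. infdist x C = R} \<in> null_sets lebesgue"
    using negligible_Un[OF Z negligible_infdist_level[OF C \<open>R > 0\<close>]]
    by (simp only: negligible_iff_null_sets)
  moreover have S_borel: "S \<in> sets borel" using borel UL by (metis (mono_tags) sets.countable_UN image_subset_iff)
  ultimately have "emeasure lebesgue A \<le> emeasure lebesgue (S \<union> (Z \<union> {x. infdist x C = R}))"
    using sets.Un[OF _ null_setsD2[OF NZ], of S] by (intro emeasure_mono) simp_all
  also have "\<dots> = emeasure lebesgue S" using NZ S_borel by (intro emeasure_Un_null_set) auto
  also have "\<dots> = (SUP n. emeasure lborel (L n))"
  proof -
    have "(SUP n. emeasure lborel (L n)) = emeasure lborel (\<Union>n. L n)"
    proof (rule SUP_emeasure_incseq)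
      show "incseq L" by (force simp: incseq_def L_def)
    qed (use borel in auto)
    then show ?thesis using S_borel UL by simp
  qed
  finally have "?k * emeasure lebesgue A \<le> ?k * (SUP n. emeasure lborel (L n))" by (rule mult_left_mono) simp
  also have "\<dots> = (SUP n. ?k * emeasure lborel (L n))" by (simp add: SUP_mult_left_ennreal)
  also have "\<dots> \<le> emeasure lebesgue (?T ` A)"
  proof (rule SUP_least)
    fix n
    have "?k * emeasure lborel (L n) \<le> emeasure lebesgue (G ` L n)" using LG(2) borel by simp
    also have "\<dots> \<le> emeasure lebesgue (?T ` A)" using meas TA by (intro emeasure_mono) auto
    finally show "?k * emeasure lborel (L n) \<le> emeasure lebesgue (?T ` A)" .
  qed
  finally show ?thesis using meas by simp
qed

end
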